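(* There is an algorithm running in time $O((m+n)n^2)$ that, given an $m \times n$ real matrix $A$, computes a coloring $x \in \{-1,+1\}^n$ satisfying $$\mathrm{disc}_2(A,x) = O\big(\sqrt{\lg n}\cdot \mathrm{herdisc}_2(A)\big).$$
   Context: For an $m \times n$ real matrix $A$ and $x \in \{-1,+1\}^n$, $\mathrm{disc}_2(A,x) := \frac{1}{\sqrt{m}}\|Ax\|_2$. For an $m\times n$ matrix $B$, $\mathrm{disc}_2(B) := \min_{x \in \{-1,+1\}^n} \frac{1}{\sqrt{m}}\|Bx\|_2$. The hereditary $\ell_2$-discrepancy is $\mathrm{herdisc}_2(A) := \max_B \mathrm{disc}_2(B)$, where $B$ ranges over all matrices obtained from $A$ by deleting a subset of its columns (keeping at least one column, and keeping all rows). The $O(\cdot)$ notation hides absolute constants. *)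

theory Defs
  imports
    "HOL-Analysis.L2_Norm"
    "Jordan_Normal_Form.Matrix"
    "Jordan_Normal_Form.DL_Submatrix"
begin

section \<open>Discrepancy\<close>

definition colorings :: "nat \<Rightarrow> real vec set" where
  "colorings n = {x \<in> carrier_vec n. \<forall>j<n. x $ j \<in> {-1, 1}}"

definition disc2_of :: "real mat \<Rightarrow> real vec \<Rightarrow> real" where
  "disc2_of A x = 1 / sqrt (real (dim_row A)) * L2_set (\<lambda>i. (A *\<^sub>v x) $ i) {..<dim_row A}"

definition disc2 :: "real mat \<Rightarrow> real" where
  "disc2 B = Min (disc2_of B ` colorings (dim_col B))"

definition herdisc2 :: "real mat \<Rightarrow> real" where
  "herdisc2 A = Max {disc2 (submatrix A UNIV J) | J. J \<subseteq> {..<dim_col A} \<and> J \<noteq> {}}"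

section \<open>The real RAM\<close>

text \<open>
  Algorithms are programs for the unit-cost real RAM. The memory consists of cells holding natural
  numbers, used for indexing and control, and of cells holding exact real numbers. Both kinds are
  organised in named arrays; a program mentions only finitely many names. The operations are
  arithmetic on naturals, field arithmetic and comparison on reals, and the embedding of naturals
  into the reals. There are no real constants other than these, no roots, and no rounding of reals
  to naturals, so that neither advice nor bit manipulation of reals is available.
\<close>

type_synonym vname = string

datatype nexp =
    NConst nat
  | NCell vname nexp
  | NAdd nexp nexp
  | NSub nexp nexp
  | NMul nexp nexp

datatype rexp =
    RNat nexp
  | RCell vname nexp
  | RAdd rexp rexp
  | RSub rexp rexp
  | RMul rexp rexp
  | RDiv rexp rexp

datatype bexp =
    NLess nexp nexp
  | RLess rexp rexp
  | BNot bexp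
  | BAnd bexp bexp

datatype com =
    Skip
  | NStore vname nexp nexp  (* array, index, value *)
  | RStore vname nexp rexp
  | Then com com
  | Cond bexp com com
  | Loop bexp com

record mem =
  ncell :: "vname \<Rightarrow> nat \<Rightarrow> nat"
  rcell :: "vname \<Rightarrow> nat \<Rightarrow> real"

primrec nval :: "mem \<Rightarrow> nexp \<Rightarrow> nat" where
  "nval s (NConst k) = k"
| "nval s (NCell a e) = ncell s a (nval s e)"
| "nval s (NAdd e f) = nval s e + nval s f"
| "nval s (NSub e f) = nval s e - nval s f"
| "nval s (NMul e f) = nval s e * nval s f"

text \<open>A division by zero yields zero.\<close>

primrec rval :: "mem \<Rightarrow> rexp \<Rightarrow> real" where
  "rval s (RNat e) = real (nval s e)"
| "rval s (RCell a e) = rcell s a (nval s e)"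
| "rval s (RAdd e f) = rval s e + rval s f"
| "rval s (RSub e f) = rval s e - rval s f"
| "rval s (RMul e f) = rval s e * rval s f"
| "rval s (RDiv e f) = rval s e / rval s f"

primrec bval :: "mem \<Rightarrow> bexp \<Rightarrow> bool" where
  "bval s (NLess e f) \<longleftrightarrow> nval s e < nval s f"
| "bval s (RLess e f) \<longleftrightarrow> rval s e < rval s f"
| "bval s (BNot b) \<longleftrightarrow> \<not> bval s b"
| "bval s (BAnd b c) \<longleftrightarrow> bval s b \<and> bval s c"

text \<open>Every constant, memory access and operation in an expression costs one time unit.\<close>

primrec ncost :: "nexp \<Rightarrow> nat" where
  "ncost (NConst k) = 1"
| "ncost (NCell a e) = 1 + ncost e"
| "ncost (NAdd e f) = 1 + ncost e + ncost f"
| "ncost (NSub e f) = 1 + ncost e + ncost f"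
| "ncost (NMul e f) = 1 + ncost e + ncost f"

primrec rcost :: "rexp \<Rightarrow> nat" where
  "rcost (RNat e) = 1 + ncost e"
| "rcost (RCell a e) = 1 + ncost e"
| "rcost (RAdd e f) = 1 + rcost e + rcost f"
| "rcost (RSub e f) = 1 + rcost e + rcost f"
| "rcost (RMul e f) = 1 + rcost e + rcost f"
| "rcost (RDiv e f) = 1 + rcost e + rcost f"

primrec bcost :: "bexp \<Rightarrow> nat" where
  "bcost (NLess e f) = 1 + ncost e + ncost f"
| "bcost (RLess e f) = 1 + rcost e + rcost f"
| "bcost (BNot b) = 1 + bcost b"
| "bcost (BAnd b c) = 1 + bcost b + bcost c"

definition nstore :: "vname \<Rightarrow> nat \<Rightarrow> nat \<Rightarrow> mem \<Rightarrow> mem" where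
  "nstore a i v s = s\<lparr>ncell := (ncell s)(a := (ncell s a)(i := v))\<rparr>"

definition rstore :: "vname \<Rightarrow> nat \<Rightarrow> real \<Rightarrow> mem \<Rightarrow> mem" where
  "rstore a i v s = s\<lparr>rcell := (rcell s)(a := (rcell s a)(i := v))\<rparr>"

text \<open>\<open>exec c s t s'\<close>: started in memory \<open>s\<close>, the program \<open>c\<close> halts after exactly \<open>t\<close> time units in
  memory \<open>s'\<close>.\<close>

inductive exec :: "com \<Rightarrow> mem \<Rightarrow> nat \<Rightarrow> mem \<Rightarrow> bool" where
  Skip: "exec Skip s 1 s"
| NStore: "exec (NStore a e f) s (1 + ncost e + ncost f) (nstore a (nval s e) (nval s f) s)"
| RStore: "exec (RStore a e f) s (1 + ncost e + rcost f) (rstore a (nval s e) (rval s f) s)"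
| Then: "exec c s t s' \<Longrightarrow> exec d s' u s'' \<Longrightarrow> exec (Then c d) s (t + u) s''"
| CondTrue: "bval s b \<Longrightarrow> exec c s t s' \<Longrightarrow> exec (Cond b c d) s (1 + bcost b + t) s'"
| CondFalse: "\<not> bval s b \<Longrightarrow> exec d s t s' \<Longrightarrow> exec (Cond b c d) s (1 + bcost b + t) s'"
| LoopFalse: "\<not> bval s b \<Longrightarrow> exec (Loop b c) s (1 + bcost b) s"
| LoopTrue: "bval s b \<Longrightarrow> exec c s t s' \<Longrightarrow> exec (Loop b c) s' u s'' \<Longrightarrow>
    exec (Loop b c) s (1 + bcost b + t + u) s''"

inductive_cases exec_elims:
  "exec Skip s t s'"
  "exec (NStore a e f) s t s'"
  "exec (RStore a e f) s t s'"
  "exec (Then c d) s t s'"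
  "exec (Cond b c d) s t s'"

inductive_cases exec_LoopE: "exec (Loop b c) s t s'"

lemma exec_deterministic:
  "exec c s t s' \<Longrightarrow> exec c s u s'' \<Longrightarrow> t = u \<and> s' = s''"
proof (induction arbitrary: u s'' rule: exec.induct)
  case (LoopTrue s b c t s' v s3)
  from LoopTrue.prems LoopTrue.hyps(1) obtain t' r v' where
    "exec c s t' r" "exec (Loop b c) r v' s''" "u = 1 + bcost b + t' + v'"
    by (auto elim: exec_LoopE)
  with LoopTrue.IH show ?case by blast
qed ((erule exec_elims exec_LoopE; fastforce)+)

section \<open>Input and output\<close>

text \<open>The dimensions and the entries of the matrix, in row-major order, are given in the arrays
  \<open>m\<close>, \<open>n\<close> and \<open>A\<close>; all other cells are zero.\<close>

definition input_mem :: "real mat \<Rightarrow> mem" where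
  "input_mem A =
    \<lparr> ncell = (\<lambda>a i. if a = ''m'' \<and> i = 0 then dim_row A
                    else if a = ''n'' \<and> i = 0 then dim_col A else 0),
      rcell = (\<lambda>a k. if a = ''A'' \<and> k < dim_row A * dim_col A
                    then A $$ (k div dim_col A, k mod dim_col A) else 0) \<rparr>"

definition output_vec :: "nat \<Rightarrow> mem \<Rightarrow> real vec" where
  "output_vec n s = vec n (rcell s ''x'')"

end

theory Submission
  imports Defs
begin

text \<open>
  Regularize the Gram matrix to \<open>G = A\<^sup>T A + \<epsilon> I\<close>, with \<open>\<epsilon>\<close> so small that this at most doubles the
  squared hereditary discrepancy \<open>H\<close> (taken without the factor \<open>1 / m\<close>). A fractional coloring \<open>x\<close> starts at \<open>0\<close>, and
  one coordinate is frozen at \<open>-1\<close> or \<open>1\<close> in each of \<open>n\<close> steps. Let \<open>J\<close> be the set of the \<open>k\<close> coordinates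
  not yet frozen and \<open>M\<close> the inverse of \<open>G\<close> on \<open>J\<close>. Then \<open>1 / M p p\<close> is the squared distance of
  column \<open>p\<close> from the span of the other columns in \<open>J\<close>. The step takes \<open>p\<close> with the least distance and
  moves \<open>x\<close> along column \<open>p\<close> of \<open>M\<close>, until a coordinate hits the boundary. With \<open>\<beta> = 1 / M p p\<close>, the
  second order term of \<open>|A x|\<^sup>2 - \<beta> |x|\<^sup>2\<close> in this direction is nonpositive, so for one of the two
  signs the quantity does not increase.

  If every column in \<open>J\<close> has squared distance at least \<open>d\<close> from the span of the others, then
  \<open>d \<le> O(H / k)\<close>: completing squares one coordinate at a time shows that the sum of
  \<open>exp (- \<tau> z\<^sup>T G z / d)\<close> over \<open>z \<in> {-1, 0, 1}\<^sup>J\<close> is at most \<open>(3/2)\<^sup>k\<close>, whereas each of the \<open>2\<^sup>k\<close> subsets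
  of \<open>J\<close> contributes a coloring with \<open>z\<^sup>T G z \<le> 2 H\<close>. Hence \<open>\<beta> \<le> O(H / k)\<close>. As \<open>\<beta>\<close> never decreases and
  the squared norm still to be gained is at most \<open>k\<close>, summation by parts gives
  \<open>|A x|\<^sup>2 \<le> O(H) (1 + 1/2 + ... + 1/n)\<close>.

  Only rank one updates of \<open>M\<close> are needed: one for each row of \<open>A\<close> to build it, and one for each
  frozen coordinate.
\<close>

section \<open>Lower bound on hereditary discrepancy from a Gaussian sum over signed vectors\<close>

section \<open>Counting signed vectors\<close>

definition quad_form :: "('a \<Rightarrow> 'a \<Rightarrow> real) \<Rightarrow> 'a set \<Rightarrow> ('a \<Rightarrow> real) \<Rightarrow> real" where
  "quad_form G J z = (\<Sum>i\<in>J. \<Sum>l\<in>J. G i l * z i * z l)"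

lemma quad_form_cong:
  "(\<And>j. j \<in> J \<Longrightarrow> z j = z' j) \<Longrightarrow> quad_form G J z = quad_form G J z'"
  unfolding quad_form_def by (intro sum.cong) auto

text \<open>Completing the square in coordinate \<open>p\<close>; the form left over on
  \<open>J\<close> is the Schur complement of \<open>G p p\<close>.\<close>

lemma quad_form_insert:
  assumes "finite J" "p \<notin> J" and sym: "\<And>i l. G i l = G l i" and "G p p > 0"
  defines "b \<equiv> \<lambda>z. \<Sum>i\<in>J. G p i * z i"
  shows "quad_form G (insert p J) z =
    G p p * (z p + b z / G p p)\<^sup>2 + quad_form (\<lambda>i l. G i l - G p i * G p l / G p p) J z"
proof -
  have b1: "(\<Sum>l\<in>J. G p l * z p * z l) = z p * b z"
    unfolding b_def by (simp add: sum_distrib_left algebra_simps)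
  have b2: "(\<Sum>i\<in>J. G i p * z i * z p) = z p * b z"
    unfolding b_def by (simp add: sum_distrib_left sym[of _ p] algebra_simps)
  have "quad_form G (insert p J) z = G p p * z p * z p + 2 * (z p * b z) + quad_form G J z"
    unfolding quad_form_def using assms(1,2) by (simp add: sum.distrib b1 b2)
  moreover have "quad_form (\<lambda>i l. G i l - G p i * G p l / G p p) J z = quad_form G J z - b z * b z / G p p"
    unfolding quad_form_def b_def sum_product
    by (simp add: sum_subtractf sum_divide_distrib algebra_simps)
  moreover have "G p p * (z p + b z / G p p)\<^sup>2 = G p p * z p * z p + 2 * (z p * b z) + b z * b z / G p p"
    using \<open>G p p > 0\<close> by (simp add: field_simps power2_eq_square)
  ultimately show ?thesis by simp
qed

text \<open>At least two of the three points have distance at least \<open>1 / 2\<close> from \<open>- c\<close>.\<close>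

lemma three_point_gaussian_bound:
  fixes c \<kappa> :: real
  assumes "\<kappa> \<ge> 4 * ln 4"
  shows "(\<Sum>t\<in>{-1, 0, 1}. exp (- \<kappa> * (t + c)\<^sup>2)) \<le> 3 / 2"
proof -
  have pos: "\<kappa> > 0" using assms by (smt (verit) ln_gt_zero)
  have small: "exp (- \<kappa> * u\<^sup>2) \<le> 1 / 4" if "\<bar>u\<bar> \<ge> 1 / 2" for u :: real
  proof -
    \<comment> \<open>The constant \<open>4 * ln 4\<close> is made for this: at distance
      \<open>1 / 2\<close> a term is at most \<open>exp (- ln 4)\<close>, so two such terms and one
      bounded by 1 add up to \<open>3 / 2\<close>.\<close>
    have "1 / 4 \<le> u\<^sup>2"
      using power_mono[of "1/2" "\<bar>u\<bar>" 2] that by (simp add: power2_eq_square)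
    then have "4 * ln 4 * (1 / 4) \<le> \<kappa> * u\<^sup>2"
      using assms pos by (intro mult_mono) auto
    then have "exp (- \<kappa> * u\<^sup>2) \<le> exp (- ln 4)" by simp
    then show ?thesis by (simp add: exp_minus)
  qed
  have one: "exp (- \<kappa> * u\<^sup>2) \<le> 1" for u :: real using pos by simp
  have "\<bar>-1 + c\<bar> \<ge> 1/2 \<and> \<bar>1 + c\<bar> \<ge> 1/2 \<or> \<bar>0 + c\<bar> \<ge> 1/2 \<and> (\<bar>-1 + c\<bar> \<ge> 1/2 \<or> \<bar>1 + c\<bar> \<ge> 1/2)"
    by linarith
  moreover have "(\<Sum>t\<in>{-1, 0, 1}. exp (- \<kappa> * (t + c)\<^sup>2)) =
      exp (- \<kappa> * (-1 + c)\<^sup>2) + (exp (- \<kappa> * (0 + c)\<^sup>2) + exp (- \<kappa> * (1 + c)\<^sup>2))"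
    by simp
  ultimately show ?thesis
    using small[of "-1 + c"] small[of "1 + c"] small[of "0 + c"]
      one[of "-1 + c"] one[of "1 + c"] one[of "0 + c"]
    by linarith
qed

text \<open>Coordinates are summed out one at a time. With the others fixed, the sum over coordinate
  \<open>p\<close> is a shifted three-point sum, at most \<open>3 / 2\<close> whatever the shift,
  and what remains is the same kind of sum for the Schur complement.\<close>

lemma gaussian_sum_bound:
  assumes "finite J" and "\<And>i l. G i l = G l i" and "d > 0"
    and "\<And>z j. j \<in> J \<Longrightarrow> d * (z j)\<^sup>2 \<le> quad_form G J z"
  shows "(\<Sum>z\<in>PiE J (\<lambda>_. {-1, 0, 1}). exp (- (4 * ln 4 / d) * quad_form G J z)) \<le> (3 / 2) ^ card J"
  using assms
proof (induction J arbitrary: G rule: finite_induct)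
  case empty
  then show ?case by (simp add: quad_form_def)
next
  case (insert p J)
  let ?F = "\<lambda>_::'a. {-1, 0, 1::real}"
  define lam where "lam = 4 * ln 4 / d"
  define b where "b z = (\<Sum>i\<in>J. G p i * z i)" for z
  define G' where "G' = (\<lambda>i l. G i l - G p i * G p l / G p p)"
  \<comment> \<open>The lower bound, tested on the unit vector of \<open>p\<close>, gives
    \<open>d \<le> G p p\<close>, so the Gaussian in this coordinate is narrow enough.\<close>
  have "quad_form G (insert p J) (\<lambda>i. if i = p then 1 else 0) =
      (\<Sum>i\<in>insert p J. if i = p then \<Sum>l\<in>insert p J. if l = p then G p p else 0 else 0)"
    unfolding quad_form_def by (intro sum.cong) (auto intro!: sum.cong)
  then have "quad_form G (insert p J) (\<lambda>i. if i = p then 1 else 0) = G p p"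
    using insert.hyps by (simp del: sum.insert)
  then have gd: "G p p \<ge> d"
    using insert.prems(3)[of p "\<lambda>i. if i = p then 1 else 0"] by simp
  then have g0: "G p p > 0" using \<open>d > 0\<close> by simp
  have split: "quad_form G (insert p J) z = G p p * (z p + b z / G p p)\<^sup>2 + quad_form G' J z" for z
    unfolding b_def G'_def using quad_form_insert[where G=G] insert.hyps insert.prems(1) g0 by blast
  have bupd: "b (z(p := t)) = b z" for z t
    unfolding b_def using insert.hyps by (intro sum.cong) auto
  have qupd: "quad_form G' J (z(p := t)) = quad_form G' J z" for z t
    using insert.hyps by (intro quad_form_cong) auto
  have IH: "(\<Sum>z\<in>PiE J ?F. exp (- lam * quad_form G' J z)) \<le> (3 / 2) ^ card J"
    unfolding lam_def
  proof (rule insert.IH[OF _ \<open>d > 0\<close>])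
    show "G' i l = G' l i" for i l unfolding G'_def using insert.prems(1) by simp
    show "d * (z j)\<^sup>2 \<le> quad_form G' J z" if "j \<in> J" for z j
    proof -
      \<comment> \<open>Setting coordinate \<open>p\<close> to the minimizer makes the square
        vanish, so the Schur complement inherits the lower bound. This is why the hypothesis ranges
        over all real vectors and not only over signed ones.\<close>
      have "d * ((z(p := - b z / G p p)) j)\<^sup>2 \<le> quad_form G (insert p J) (z(p := - b z / G p p))"
        using insert.prems(3) that by blast
      then show ?thesis
        unfolding split bupd qupd using that insert.hyps by (auto split: if_splits)
    qed
  qed
  have "lam * G p p \<ge> lam * d"
    using gd \<open>d > 0\<close> unfolding lam_def by (intro mult_left_mono) auto
  then have \<kappa>: "lam * G p p \<ge> 4 * ln 4"
    unfolding lam_def using \<open>d > 0\<close> by simp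
  have "(\<Sum>z\<in>PiE (insert p J) ?F. exp (- lam * quad_form G (insert p J) z))
      = (\<Sum>(t, z)\<in>{-1, 0, 1} \<times> PiE J ?F. exp (- lam * quad_form G (insert p J) (z(p := t))))"
    unfolding PiE_insert_eq
    by (subst sum.reindex[OF inj_combinator[OF insert.hyps(2)]]) (auto intro!: sum.cong)
  also have "\<dots> = (\<Sum>z\<in>PiE J ?F. \<Sum>t\<in>{-1, 0, 1}. exp (- lam * quad_form G (insert p J) (z(p := t))))"
    by (subst sum.swap) (simp add: sum.cartesian_product)
  also have "\<dots> = (\<Sum>z\<in>PiE J ?F. (\<Sum>t\<in>{-1, 0, 1}. exp (- (lam * G p p) * (t + b z / G p p)\<^sup>2)) * exp (- lam * quad_form G' J z))"
    unfolding sum_distrib_right split bupd qupd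
    by (intro sum.cong refl) (simp add: exp_add[symmetric] algebra_simps)
  also have "\<dots> \<le> (\<Sum>z\<in>PiE J ?F. 3 / 2 * exp (- lam * quad_form G' J z))"
    by (intro sum_mono mult_right_mono three_point_gaussian_bound \<kappa>) auto
  also have "\<dots> \<le> 3 / 2 * (3 / 2) ^ card J"
    unfolding sum_distrib_left[symmetric] using IH by simp
  finally show ?case
    unfolding lam_def using insert.hyps by simp
qed

text \<open>What results from solving
  \<open>2 ^ k * exp (- \<tau> * K / d) \<le> (3 / 2) ^ k\<close> with
  \<open>\<tau> = 4 * ln 4\<close> for \<open>d * k\<close>; here \<open>ln (4 / 3)\<close> is
  \<open>ln 2 - ln (3 / 2)\<close>.\<close>

definition disc_const :: real where "disc_const = 4 * ln 4 / ln (4 / 3)"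

text \<open>Every subset of \<open>J\<close> supplies a vector of small quadratic form, and these
  vectors differ because the support recovers the subset. The Gaussian sum therefore has
  \<open>2 ^ card J\<close> large terms, while it is at most
  \<open>(3 / 2) ^ card J\<close>.\<close>

lemma hereditary_lower_bound:
  assumes "finite J" and "\<And>i l. G i l = G l i" and "d > 0"
    and low: "\<And>z j. j \<in> J \<Longrightarrow> d * (z j)\<^sup>2 \<le> quad_form G J z"
    and up: "\<And>S. S \<subseteq> J \<Longrightarrow> \<exists>z. (\<forall>l\<in>S. z l \<in> {-1, 1}) \<and> (\<forall>l. l \<notin> S \<longrightarrow> z l = 0) \<and> quad_form G J z \<le> K"
  shows "d * card J \<le> disc_const * K"
proof -
  define lam where "lam = 4 * ln 4 / d"
  have lam0: "lam > 0" unfolding lam_def using \<open>d > 0\<close> by simp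
  obtain zs where zs: "\<And>S. S \<subseteq> J \<Longrightarrow> (\<forall>l\<in>S. zs S l \<in> {-1, 1}) \<and> (\<forall>l. l \<notin> S \<longrightarrow> zs S l = 0) \<and> quad_form G J (zs S) \<le> K"
    using up by metis
  \<comment> \<open>Restriction makes the vectors extensional, as membership in \<open>PiE\<close>
    demands; the quadratic form sees only the values on \<open>J\<close>.\<close>
  define w where "w S = restrict (zs S) J" for S
  have wS: "{l \<in> J. w S l \<noteq> 0} = S" if "S \<subseteq> J" for S
    using zs[OF that] that unfolding w_def by fastforce
  have inj: "inj_on w (Pow J)" by (rule inj_onI) (metis PowD wS)
  have sub: "w ` Pow J \<subseteq> PiE J (\<lambda>_. {-1, 0, 1})"
  proof (rule image_subsetI)
    fix S assume "S \<in> Pow J"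
    then have "zs S l \<in> {-1, 0, 1}" for l using zs[of S] by (cases "l \<in> S") auto
    then show "w S \<in> PiE J (\<lambda>_. {-1, 0, 1})" unfolding w_def by auto
  qed
  have "2 ^ card J * exp (- lam * K) = (\<Sum>S\<in>Pow J. exp (- lam * K))"
    by (simp add: card_Pow[OF \<open>finite J\<close>])
  also have "\<dots> \<le> (\<Sum>S\<in>Pow J. exp (- lam * quad_form G J (w S)))"
  proof (intro sum_mono)
    fix S assume "S \<in> Pow J"
    then have "quad_form G J (w S) \<le> K"
      using zs[of S] quad_form_cong[of J "w S" "zs S" G] unfolding w_def by auto
    then show "exp (- lam * K) \<le> exp (- lam * quad_form G J (w S))" using lam0 by simp
  qed
  also have "\<dots> = (\<Sum>z\<in>w ` Pow J. exp (- lam * quad_form G J z))"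
    by (simp add: sum.reindex[OF inj])
  also have "\<dots> \<le> (\<Sum>z\<in>PiE J (\<lambda>_. {-1, 0, 1}). exp (- lam * quad_form G J z))"
    by (rule sum_mono2[OF _ sub]) (auto intro: finite_PiE \<open>finite J\<close>)
  also have "\<dots> \<le> (3 / 2) ^ card J"
    unfolding lam_def by (rule gaussian_sum_bound) (use assms in auto)
  finally have "ln (2 ^ card J * exp (- lam * K)) \<le> ln ((3 / 2) ^ card J)"
    by (subst ln_le_cancel_iff) auto
  then have "card J * ln 2 - lam * K \<le> card J * ln (3 / 2)"
    by (simp add: ln_mult ln_realpow)
  moreover have "card J * ln (4 / 3) = card J * ln 2 - card J * ln (3 / 2 :: real)"
    using ln_div[of 2 "3 / 2 :: real"] by (simp add: right_diff_distrib)
  ultimately have "card J * ln (4 / 3) \<le> lam * K" by linarith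
  then show ?thesis
    unfolding lam_def disc_const_def using \<open>d > 0\<close> by (simp add: field_simps)
qed

section \<open>Principal inverses of the regularized Gram matrix and their rank one updates\<close>

section \<open>Inverses of regularized Gram matrices\<close>

text \<open>The number \<open>m\<close> of rows is a parameter so that the matrix can be built up
  row by row from \<open>\<epsilon>\<close> times the identity.\<close>

definition gram :: "nat \<Rightarrow> (nat \<Rightarrow> nat \<Rightarrow> real) \<Rightarrow> real \<Rightarrow> nat \<Rightarrow> nat \<Rightarrow> real" where
  "gram m a \<epsilon> i l = (\<Sum>r<m. a r i * a r l) + (if i = l then \<epsilon> else 0)"

definition energy :: "nat \<Rightarrow> (nat \<Rightarrow> nat \<Rightarrow> real) \<Rightarrow> nat set \<Rightarrow> (nat \<Rightarrow> real) \<Rightarrow> real" where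
  "energy m a J z = (\<Sum>r<m. (\<Sum>l\<in>J. a r l * z l)\<^sup>2)"

lemma gram_commute: "gram m a \<epsilon> i l = gram m a \<epsilon> l i"
  unfolding gram_def by (simp add: mult.commute)

lemma bilinear_gram:
  assumes "finite J"
  shows "(\<Sum>i\<in>J. \<Sum>l\<in>J. gram m a \<epsilon> i l * y i * z l) =
    (\<Sum>r<m. (\<Sum>l\<in>J. a r l * y l) * (\<Sum>l\<in>J. a r l * z l)) + \<epsilon> * (\<Sum>l\<in>J. y l * z l)"
proof -
  have "(\<Sum>i\<in>J. \<Sum>l\<in>J. (\<Sum>r<m. a r i * a r l) * y i * z l) =
      (\<Sum>i\<in>J. \<Sum>r<m. \<Sum>l\<in>J. a r i * y i * (a r l * z l))"
    by (subst sum.swap) (simp add: sum_distrib_left sum_distrib_right mult_ac)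
  also have "\<dots> = (\<Sum>r<m. (\<Sum>l\<in>J. a r l * y l) * (\<Sum>l\<in>J. a r l * z l))"
    by (subst sum.swap) (simp add: sum_product)
  finally have 1: "(\<Sum>i\<in>J. \<Sum>l\<in>J. (\<Sum>r<m. a r i * a r l) * y i * z l) =
    (\<Sum>r<m. (\<Sum>l\<in>J. a r l * y l) * (\<Sum>l\<in>J. a r l * z l))" .
  have "(\<Sum>i\<in>J. \<Sum>l\<in>J. (if i = l then \<epsilon> else 0) * y i * z l) = (\<Sum>i\<in>J. \<Sum>l\<in>J. if i = l then \<epsilon> * y i * z i else 0)"
    by (intro sum.cong) auto
  also have "\<dots> = \<epsilon> * (\<Sum>l\<in>J. y l * z l)"
    using assms by (simp add: sum_distrib_left mult_ac)
  finally show ?thesis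
    unfolding gram_def using 1 by (simp add: distrib_right sum.distrib)
qed

lemma quad_form_gram:
  assumes "finite J"
  shows "quad_form (gram m a \<epsilon>) J z = energy m a J z + \<epsilon> * (\<Sum>l\<in>J. (z l)\<^sup>2)"
  unfolding quad_form_def bilinear_gram[OF assms] energy_def by (simp add: power2_eq_square)

text \<open>The matrix \<open>M\<close>, of which only the entries below \<open>n\<close> matter, is the inverse of the principal
  submatrix of \<open>G\<close> on \<open>J\<close>, padded with zeros.\<close>

definition inverse_on :: "nat \<Rightarrow> nat set \<Rightarrow> (nat \<Rightarrow> nat \<Rightarrow> real) \<Rightarrow> (nat \<Rightarrow> nat \<Rightarrow> real) \<Rightarrow> bool" where
  "inverse_on n J G M \<longleftrightarrow> J \<subseteq> {..<n} \<and>
     (\<forall>i<n. \<forall>l<n. M i l = M l i) \<and>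
     (\<forall>i<n. \<forall>l<n. i \<notin> J \<longrightarrow> M i l = 0) \<and>
     (\<forall>i\<in>J. \<forall>l\<in>J. (\<Sum>q\<in>J. G i q * M q l) = (if i = l then 1 else 0))"

lemma inverse_on_finite: "inverse_on n J G M \<Longrightarrow> finite J"
  unfolding inverse_on_def using finite_subset by blast

text \<open>Column \<open>j\<close> of \<open>M\<close> represents evaluation at coordinate
  \<open>j\<close> in the inner product given by the Gram matrix.\<close>

lemma inverse_on_bilinear:
  assumes "inverse_on n J (gram m a \<epsilon>) M" and "j \<in> J"
  shows "(\<Sum>i\<in>J. \<Sum>l\<in>J. gram m a \<epsilon> i l * z i * M l j) = z j"
proof -
  have "(\<Sum>i\<in>J. \<Sum>l\<in>J. gram m a \<epsilon> i l * z i * M l j) = (\<Sum>i\<in>J. z i * (\<Sum>l\<in>J. gram m a \<epsilon> i l * M l j))"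
    by (simp add: sum_distrib_left mult_ac)
  also have "\<dots> = (\<Sum>i\<in>J. z i * (if i = j then 1 else 0))"
    using assms unfolding inverse_on_def by (intro sum.cong) auto
  also have "\<dots> = (\<Sum>i\<in>J. if i = j then z i else 0)"
    by (intro sum.cong) auto
  also have "\<dots> = z j"
    using assms inverse_on_finite by simp
  finally show ?thesis .
qed

text \<open>Column \<open>j\<close> is paired with itself: its quadratic form is its own entry at
  \<open>j\<close>.\<close>

lemma inverse_on_diag:
  assumes "inverse_on n J (gram m a \<epsilon>) M" and "j \<in> J"
  shows "M j j = energy m a J (\<lambda>l. M l j) + \<epsilon> * (\<Sum>l\<in>J. (M l j)\<^sup>2)"
  using inverse_on_bilinear[OF assms, of "\<lambda>l. M l j"] quad_form_gram[OF inverse_on_finite[OF assms(1)]]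
  unfolding quad_form_def by metis

lemma energy_nonneg: "energy m a J z \<ge> 0"
  unfolding energy_def by (simp add: sum_nonneg)

text \<open>Otherwise the regularizing term would force column \<open>j\<close> to vanish on
  \<open>J\<close>, but its product with row \<open>j\<close> of the Gram matrix is 1.\<close>

lemma inverse_on_diag_pos:
  assumes M: "inverse_on n J (gram m a \<epsilon>) M" and "j \<in> J" and "\<epsilon> > 0"
  shows "M j j > 0"
proof (rule ccontr)
  assume "\<not> M j j > 0"
  moreover have "(\<Sum>l\<in>J. (M l j)\<^sup>2) \<ge> 0" by (simp add: sum_nonneg)
  ultimately have "\<epsilon> * (\<Sum>l\<in>J. (M l j)\<^sup>2) \<le> 0"
    using inverse_on_diag[OF assms(1,2)] energy_nonneg[of m a J "\<lambda>l. M l j"] by linarith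
  then have "(\<Sum>l\<in>J. (M l j)\<^sup>2) = 0"
    using \<open>(\<Sum>l\<in>J. (M l j)\<^sup>2) \<ge> 0\<close> \<open>\<epsilon> > 0\<close> by (simp add: mult_le_0_iff)
  then have z: "\<forall>l\<in>J. M l j = 0"
    using inverse_on_finite[OF M] by (simp add: sum_nonneg_eq_0_iff)
  moreover have "(\<Sum>q\<in>J. gram m a \<epsilon> j q * M q j) = 1"
    using M \<open>j \<in> J\<close> unfolding inverse_on_def by auto
  ultimately show False by simp
qed

text \<open>\<open>1 / M j j\<close> is the squared distance of column \<open>j\<close> from the span of the other columns in \<open>J\<close>.\<close>

lemma inverse_on_quad_form_ge:
  assumes M: "inverse_on n J (gram m a \<epsilon>) M" and "j \<in> J" and "\<epsilon> > 0"
  shows "(z j)\<^sup>2 \<le> M j j * quad_form (gram m a \<epsilon>) J z"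
proof -
  let ?Q = "quad_form (gram m a \<epsilon>) J"
  have fin: "finite J" using M by (rule inverse_on_finite)
  \<comment> \<open>The minimizer of the form at \<open>z\<close> minus \<open>t\<close> times
    column \<open>j\<close>; nonnegativity there is the Cauchy-Schwarz inequality for
    \<open>z\<close> and this column.\<close>
  define t where "t = z j / M j j"
  have pos: "M j j > 0" using inverse_on_diag_pos assms by blast
  have "0 \<le> ?Q (\<lambda>l. z l - t * M l j)"
    unfolding quad_form_gram[OF fin] using \<open>\<epsilon> > 0\<close> by (simp add: energy_nonneg sum_nonneg)
  also have "?Q (\<lambda>l. z l - t * M l j) = ?Q z - t * (\<Sum>i\<in>J. \<Sum>l\<in>J. gram m a \<epsilon> i l * z i * M l j)
      - t * (\<Sum>i\<in>J. \<Sum>l\<in>J. gram m a \<epsilon> i l * M i j * z l)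
      + t * t * (\<Sum>i\<in>J. \<Sum>l\<in>J. gram m a \<epsilon> i l * M i j * M l j)"
    unfolding quad_form_def by (simp add: sum_distrib_left sum_subtractf sum.distrib algebra_simps)
  also have "(\<Sum>i\<in>J. \<Sum>l\<in>J. gram m a \<epsilon> i l * M i j * z l) = (\<Sum>i\<in>J. \<Sum>l\<in>J. gram m a \<epsilon> i l * z i * M l j)"
    by (subst sum.swap) (simp add: gram_commute[of m a \<epsilon>] mult_ac)
  finally have "0 \<le> ?Q z - 2 * t * z j + t * t * M j j"
    unfolding inverse_on_bilinear[OF M \<open>j \<in> J\<close>] by simp
  also have "\<dots> = ?Q z - (z j)\<^sup>2 / M j j"
    unfolding t_def using pos by (simp add: field_simps power2_eq_square)
  finally show ?thesis using pos by (simp add: field_simps)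
qed

lemma inverse_on_init:
  assumes "\<epsilon> > 0" and "\<And>i l. i < n \<Longrightarrow> l < n \<Longrightarrow> M i l = (if i = l then 1 / \<epsilon> else 0)"
  shows "inverse_on n {..<n} (gram 0 a \<epsilon>) M"
proof -
  have "(\<Sum>q<n. gram 0 a \<epsilon> i q * M q l) = (\<Sum>q<n. if q = i then (if i = l then 1 else 0) else 0)"
    if "i < n" "l < n" for i l
    using assms that by (intro sum.cong) (auto simp: gram_def)
  then show ?thesis
    unfolding inverse_on_def using assms(2) by auto
qed

text \<open>This is the Sherman--Morrison formula.\<close>

lemma inverse_on_add_row:
  assumes M: "inverse_on n {..<n} (gram m a \<epsilon>) M" and "\<epsilon> > 0"
    and u: "\<And>l. l < n \<Longrightarrow> u l = (\<Sum>q<n. M l q * a m q)"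
    and s: "s = 1 + (\<Sum>l<n. a m l * u l)"
    and M': "\<And>i l. i < n \<Longrightarrow> l < n \<Longrightarrow> M' i l = M i l - u i * u l / s"
  shows "inverse_on n {..<n} (gram (Suc m) a \<epsilon>) M'"
proof -
  let ?G = "gram m a \<epsilon>"
  have sym: "M i l = M l i" if "i < n" "l < n" for i l using M that unfolding inverse_on_def by blast
  have GM: "(\<Sum>q<n. ?G i q * M q l) = (if i = l then 1 else 0)" if "i < n" "l < n" for i l
    using M that unfolding inverse_on_def by auto
  have Gu: "(\<Sum>q<n. ?G i q * u q) = a m i" if "i < n" for i
  proof -
    have "(\<Sum>q<n. ?G i q * u q) = (\<Sum>q<n. \<Sum>l<n. ?G i q * M q l * a m l)"
      by (simp add: u sum_distrib_left mult_ac)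
    also have "\<dots> = (\<Sum>l<n. (\<Sum>q<n. ?G i q * M q l) * a m l)"
      by (subst sum.swap) (simp add: sum_distrib_right)
    also have "\<dots> = (\<Sum>l<n. if l = i then a m i else 0)"
      using that by (intro sum.cong) (auto simp: GM)
    also have "\<dots> = a m i" using that by simp
    finally show ?thesis .
  qed
  \<comment> \<open>By \<open>Gu\<close> this is the quadratic form at \<open>u\<close>, hence
    nonnegative, so the denominator \<open>s\<close> of the update is positive.\<close>
  have "(\<Sum>l<n. a m l * u l) = (\<Sum>l<n. \<Sum>q<n. ?G l q * u l * u q)"
    using Gu[symmetric] by (simp add: sum_distrib_left sum_distrib_right mult_ac)
  also have "\<dots> = quad_form ?G {..<n} u" unfolding quad_form_def ..
  also have "\<dots> \<ge> 0"
    using \<open>\<epsilon> > 0\<close> by (simp add: quad_form_gram energy_nonneg sum_nonneg)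
  finally have s0: "s > 0" unfolding s by simp
  have aM: "(\<Sum>q<n. a m q * M q l) = u l" if "l < n" for l
    using that u sym by (simp add: mult.commute)
  have "(\<Sum>q<n. gram (Suc m) a \<epsilon> i q * M' q l) = (if i = l then 1 else 0)" if "i < n" "l < n" for i l
  proof -
    have "(\<Sum>q<n. gram (Suc m) a \<epsilon> i q * M' q l) =
       (\<Sum>q<n. ?G i q * M q l + a m i * (a m q * M q l) - ?G i q * u q * (u l / s) - a m i * (a m q * u q) * (u l / s))"
      using that by (intro sum.cong) (auto simp: M' gram_def algebra_simps)
    also have "\<dots> = (\<Sum>q<n. ?G i q * M q l) + a m i * (\<Sum>q<n. a m q * M q l)
        - (\<Sum>q<n. ?G i q * u q) * (u l / s) - a m i * (\<Sum>q<n. a m q * u q) * (u l / s)"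
      by (simp add: sum.distrib sum_subtractf sum_distrib_left sum_distrib_right mult_ac)
    also have "\<dots> = (if i = l then 1 else 0) + a m i * u l - a m i * (u l / s) - a m i * (s - 1) * (u l / s)"
      unfolding GM[OF that] aM[OF that(2)] Gu[OF that(1)] by (simp add: s)
    also have "\<dots> = (if i = l then 1 else 0)"
      using s0 by (simp add: field_simps)
    finally show ?thesis .
  qed
  then show ?thesis
    unfolding inverse_on_def using M' sym by (auto simp: mult.commute)
qed

text \<open>The correction subtracts multiples of column \<open>f\<close> of \<open>M\<close>. The
  Gram matrix maps that column to zero in every row of \<open>J\<close> other than \<open>f\<close>,
  so the inverse property survives there, while row and column \<open>f\<close> of \<open>M'\<close>
  become zero.\<close>

lemma inverse_on_remove:
  assumes M: "inverse_on n J (gram m a \<epsilon>) M" and f: "f \<in> J" and "\<epsilon> > 0"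
    and M': "\<And>i l. i < n \<Longrightarrow> l < n \<Longrightarrow> M' i l = M i l - M i f * M l f / M f f"
  shows "inverse_on n (J - {f}) (gram m a \<epsilon>) M'"
proof -
  let ?G = "gram m a \<epsilon>"
  have fin: "finite J" using M by (rule inverse_on_finite)
  have J: "J \<subseteq> {..<n}" using M unfolding inverse_on_def by blast
  have fn: "f < n" using f J by auto
  have sym: "M i l = M l i" if "i < n" "l < n" for i l using M that unfolding inverse_on_def by blast
  have pos: "M f f > 0" using inverse_on_diag_pos assms by blast
  have Mf: "M' f l = 0" if "l < n" for l using M'[OF fn that] sym[OF fn that] pos by simp
  have "(\<Sum>q\<in>J - {f}. ?G i q * M' q l) = (if i = l then 1 else 0)" if "i \<in> J - {f}" "l \<in> J - {f}" for i l
  proof -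
    have ln: "l < n" using that J by auto
    \<comment> \<open>The term at \<open>f\<close> may be put back because
      \<open>M' f l = 0\<close>; the inverse property of \<open>M\<close> on all of \<open>J\<close>
      then applies.\<close>
    have "(\<Sum>q\<in>J - {f}. ?G i q * M' q l) = (\<Sum>q\<in>J. ?G i q * M' q l)"
      using fin Mf[OF ln] by (intro sum.mono_neutral_left) auto
    also have "\<dots> = (\<Sum>q\<in>J. ?G i q * M q l - ?G i q * M q f * (M l f / M f f))"
      using J ln by (intro sum.cong) (auto simp: M' algebra_simps)
    also have "\<dots> = (\<Sum>q\<in>J. ?G i q * M q l) - (\<Sum>q\<in>J. ?G i q * M q f) * (M l f / M f f)"
      by (simp add: sum_subtractf sum_distrib_right sum_divide_distrib)
    also have "\<dots> = (if i = l then 1 else 0)"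
      using M that f unfolding inverse_on_def by auto
    finally show ?thesis .
  qed
  moreover have "M' i l = 0" if "i < n" "l < n" "i \<notin> J - {f}" for i l
  proof (cases "i = f")
    case False
    then show ?thesis using M M'[OF that(1,2)] that fn unfolding inverse_on_def by auto
  qed (use Mf that in auto)
  ultimately show ?thesis
    unfolding inverse_on_def using J M' sym by (auto simp: mult.commute)
qed

section \<open>The potential of the walk and its change in one step\<close>

section \<open>The walk\<close>

definition harmonic :: "nat \<Rightarrow> real" where
  "harmonic n = (\<Sum>k=1..n. inverse (real k))"

lemma harmonic_Suc: "harmonic (Suc n) = harmonic n + inverse (real (Suc n))"
  unfolding harmonic_def by simp

lemma harmonic_nonneg: "harmonic n \<ge> 0"
  unfolding harmonic_def by (simp add: sum_nonneg)

text \<open>The increment \<open>1 / (n + 1)\<close> is at most \<open>ln (n + 1) - ln n\<close>, by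
  \<open>ln t \<le> t - 1\<close> at \<open>t = n / (n + 1)\<close>.\<close>

lemma harmonic_le_ln:
  assumes "n \<ge> 1"
  shows "harmonic n \<le> 1 + ln (real n)"
  using assms
proof (induction n rule: dec_induct)
  case base
  then show ?case by (simp add: harmonic_def)
next
  case (step n)
  have "ln (real n / real (Suc n)) \<le> real n / real (Suc n) - 1"
    using step.hyps by (intro ln_le_minus_one) auto
  also have "\<dots> = - inverse (real (Suc n))" by (simp add: field_simps)
  finally have "inverse (real (Suc n)) \<le> ln (real (Suc n)) - ln (real n)"
    using step.hyps by (simp add: ln_div)
  then show ?case using step.IH by (simp add: harmonic_Suc)
qed

lemma energy_add_scaled:
  "energy m a J (\<lambda>l. x l + t * y l) = energy m a J x
    + 2 * t * (\<Sum>r<m. (\<Sum>l\<in>J. a r l * x l) * (\<Sum>l\<in>J. a r l * y l)) + t\<^sup>2 * energy m a J y"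
proof -
  define X where "X r = (\<Sum>l\<in>J. a r l * x l)" for r
  define Y where "Y r = (\<Sum>l\<in>J. a r l * y l)" for r
  have "(\<Sum>l\<in>J. a r l * (x l + t * y l)) = X r + t * Y r" for r
    unfolding X_def Y_def by (simp add: sum.distrib sum_distrib_left algebra_simps)
  moreover have "(X r + t * Y r)\<^sup>2 = (X r)\<^sup>2 + 2 * t * (X r * Y r) + t\<^sup>2 * (Y r)\<^sup>2" for r
    by (simp add: power2_eq_square algebra_simps)
  ultimately show ?thesis
    unfolding energy_def X_def[symmetric] Y_def[symmetric]
    by (simp add: sum.distrib sum_distrib_left)
qed

text \<open>Along column \<open>p\<close> of \<open>M\<close> the quadratic part of the energy is at most \<open>1 / M p p\<close> times that of the
  squared norm, so it only remains to choose the sign of the linear part.\<close>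

lemma energy_step:
  assumes M: "inverse_on n J (gram m a \<epsilon>) M" and "\<epsilon> > 0" and p: "p \<in> J"
    and sign: "t * (M p p * (\<Sum>r<m. (\<Sum>l<n. a r l * x l) * (\<Sum>l<n. a r l * M l p)) - (\<Sum>l<n. x l * M l p)) \<le> 0"
    and x': "\<And>l. l < n \<Longrightarrow> x' l = x l + t * M l p"
  shows "energy m a {..<n} x' - energy m a {..<n} x \<le> ((\<Sum>l<n. (x' l)\<^sup>2) - (\<Sum>l<n. (x l)\<^sup>2)) / M p p"
proof -
  define c where "c = (\<Sum>r<m. (\<Sum>l<n. a r l * x l) * (\<Sum>l<n. a r l * M l p))"
  define e where "e = (\<Sum>l<n. x l * M l p)"
  define E where "E = energy m a {..<n} (\<lambda>l. M l p)"
  define N where "N = (\<Sum>l<n. (M l p)\<^sup>2)"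
  have J: "J \<subseteq> {..<n}" and z: "\<And>l. l < n \<Longrightarrow> l \<notin> J \<Longrightarrow> M l p = 0"
    using M p unfolding inverse_on_def by auto
  have pn: "p < n" using p J by auto
  have pos: "M p p > 0" using inverse_on_diag_pos assms by blast
  have "(\<Sum>l<n. a r l * M l p) = (\<Sum>l\<in>J. a r l * M l p)" for r
    using J z by (intro sum.mono_neutral_right) auto
  then have "E = energy m a J (\<lambda>l. M l p)" unfolding E_def energy_def by simp
  \<comment> \<open>Dropping the regularizing term bounds the energy of the column by
    \<open>M p p\<close>, and its squared norm contains the summand \<open>(M p p)\<^sup>2\<close>;
    together they compare the quadratic parts.\<close>
  then have "E \<le> M p p"
    using inverse_on_diag[OF M p] \<open>\<epsilon> > 0\<close> by (simp add: sum_nonneg)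
  then have "M p p * E \<le> (M p p)\<^sup>2" using pos by (simp add: power2_eq_square)
  also have "\<dots> \<le> N"
    unfolding N_def using pn by (intro member_le_sum) auto
  finally have EN: "M p p * E \<le> N" .
  have "energy m a {..<n} x' = energy m a {..<n} (\<lambda>l. x l + t * M l p)"
    unfolding energy_def using x' by simp
  also have "\<dots> = energy m a {..<n} x + 2 * t * c + t\<^sup>2 * E"
    unfolding energy_add_scaled c_def E_def ..
  finally have 1: "energy m a {..<n} x' - energy m a {..<n} x = 2 * t * c + t\<^sup>2 * E" by simp
  have "(\<Sum>l<n. (x' l)\<^sup>2) = (\<Sum>l<n. (x l)\<^sup>2 + 2 * t * (x l * M l p) + t\<^sup>2 * (M l p)\<^sup>2)"
    using x' by (intro sum.cong) (auto simp: power2_eq_square algebra_simps)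
  then have 2: "(\<Sum>l<n. (x' l)\<^sup>2) - (\<Sum>l<n. (x l)\<^sup>2) = 2 * t * e + t\<^sup>2 * N"
    unfolding e_def N_def by (simp add: sum.distrib sum_distrib_left)
  have "t\<^sup>2 * (M p p * E) \<le> t\<^sup>2 * N" using EN by (intro mult_left_mono) auto
  then have "M p p * (2 * t * c + t\<^sup>2 * E) \<le> 2 * t * e + t\<^sup>2 * N"
    using sign unfolding c_def[symmetric] e_def[symmetric] by (simp add: algebra_simps)
  then show ?thesis unfolding 1 2 using pos by (simp add: field_simps)
qed

text \<open>\<open>H\<close> is an upper bound for the squared, unnormalized hereditary discrepancy.
  A coloring of the columns in \<open>S\<close> is extended by zero, so that all column sets share
  one index range; \<open>S = {}\<close> says \<open>H \<ge> 0\<close>.\<close>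

definition herdisc_bound :: "nat \<Rightarrow> nat \<Rightarrow> (nat \<Rightarrow> nat \<Rightarrow> real) \<Rightarrow> real \<Rightarrow> bool" where
  "herdisc_bound m n a H \<longleftrightarrow> (\<forall>S\<subseteq>{..<n}. \<exists>z. (\<forall>l\<in>S. z l \<in> {-1, 1}) \<and> (\<forall>l. l \<notin> S \<longrightarrow> z l = 0) \<and> energy m a {..<n} z \<le> H)"

text \<open>The counting bound with \<open>d = 1 / M p p\<close>: a maximal diagonal entry makes
  this a lower bound for all squared distances. Regularization raises the form of a signed vector by
  at most \<open>\<epsilon> * n\<close>.\<close>

lemma max_diag_bound:
  assumes M: "inverse_on n J (gram m a \<epsilon>) M" and "\<epsilon> > 0" and p: "p \<in> J"
    and max: "\<And>l. l < n \<Longrightarrow> M l l \<le> M p p" and H: "herdisc_bound m n a H"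
  shows "1 / M p p \<le> disc_const * (H + \<epsilon> * real n) / real (card J)"
proof -
  have fin: "finite J" using M by (rule inverse_on_finite)
  have J: "J \<subseteq> {..<n}" using M unfolding inverse_on_def by blast
  have pos: "M p p > 0" using inverse_on_diag_pos assms by blast
  have "1 / M p p * card J \<le> disc_const * (H + \<epsilon> * real n)"
  proof (rule hereditary_lower_bound[OF fin gram_commute[of m a \<epsilon>]])
    show "1 / M p p > 0" using pos by simp
    show "1 / M p p * (z j)\<^sup>2 \<le> quad_form (gram m a \<epsilon>) J z" if "j \<in> J" for z j
    proof -
      have "(z j)\<^sup>2 \<le> M j j * quad_form (gram m a \<epsilon>) J z"
        by (rule inverse_on_quad_form_ge) (use M that \<open>\<epsilon> > 0\<close> in auto)
      also have "\<dots> \<le> M p p * quad_form (gram m a \<epsilon>) J z"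
        using that J \<open>\<epsilon> > 0\<close>
        by (intro mult_right_mono max) (auto simp: quad_form_gram[OF fin] energy_nonneg sum_nonneg)
      finally show ?thesis using pos by (simp add: field_simps)
    qed
    show "\<exists>z. (\<forall>l\<in>S. z l \<in> {-1, 1}) \<and> (\<forall>l. l \<notin> S \<longrightarrow> z l = 0) \<and> quad_form (gram m a \<epsilon>) J z \<le> H + \<epsilon> * n"
      if "S \<subseteq> J" for S
    proof -
      obtain z where z: "\<forall>l\<in>S. z l \<in> {-1, 1}" "\<forall>l. l \<notin> S \<longrightarrow> z l = 0" "energy m a {..<n} z \<le> H"
        using H \<open>S \<subseteq> J\<close> J unfolding herdisc_bound_def by (meson subset_trans)
      have "(\<Sum>l<n. a r l * z l) = (\<Sum>l\<in>J. a r l * z l)" for r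
        using J z(2) \<open>S \<subseteq> J\<close> by (intro sum.mono_neutral_right) auto
      then have 1: "energy m a J z \<le> H" using z(3) unfolding energy_def by simp
      have "(\<Sum>l\<in>J. (z l)\<^sup>2) \<le> (\<Sum>l\<in>J. 1)"
      proof (intro sum_mono)
        show "(z l)\<^sup>2 \<le> 1" for l using z(1,2) by (cases "l \<in> S") auto
      qed
      also have "\<dots> \<le> n" using card_mono[OF _ J] by simp
      finally have "\<epsilon> * (\<Sum>l\<in>J. (z l)\<^sup>2) \<le> \<epsilon> * n" using \<open>\<epsilon> > 0\<close> by simp
      then show ?thesis using z 1 quad_form_gram[OF fin] by (metis add_mono)
    qed
  qed
  moreover have "card J > 0" using p fin by (auto simp: card_gt_0_iff)
  ultimately show ?thesis by (simp add: field_simps)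
qed

text \<open>The set \<open>J\<close> consists of the coordinates that may still move. The factor of \<open>\<beta>\<close> is nonpositive, so the
  potential on the left-hand side drops when \<open>\<beta>\<close> is raised, and it grows by at most \<open>\<beta>\<close> when a coordinate
  is frozen.\<close>

definition walk_inv :: "nat \<Rightarrow> nat \<Rightarrow> (nat \<Rightarrow> nat \<Rightarrow> real) \<Rightarrow> real \<Rightarrow> real \<Rightarrow> nat set \<Rightarrow> (nat \<Rightarrow> nat \<Rightarrow> real) \<Rightarrow> (nat \<Rightarrow> real) \<Rightarrow> bool" where
  "walk_inv m n a \<epsilon> B J M x \<longleftrightarrow> inverse_on n J (gram m a \<epsilon>) M \<and>
     (\<forall>l<n. \<bar>x l\<bar> \<le> 1) \<and> (\<forall>l<n. l \<notin> J \<longrightarrow> x l \<in> {-1, 1}) \<and>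
     (\<exists>\<beta>\<ge>0. (\<forall>l<n. \<beta> * M l l \<le> 1) \<and>
        energy m a {..<n} x + \<beta> * (real n - (\<Sum>l<n. (x l)\<^sup>2) - real (card J)) \<le> B * (harmonic n - harmonic (card J)))"

text \<open>With \<open>\<beta> = 0\<close> both sides of the potential inequality are zero.\<close>

lemma walk_inv_init:
  assumes "inverse_on n {..<n} (gram m a \<epsilon>) M" and "\<And>l. l < n \<Longrightarrow> x l = 0"
  shows "walk_inv m n a \<epsilon> B {..<n} M x"
  using assms unfolding walk_inv_def energy_def by (auto intro!: exI[of _ 0])

text \<open>Once nothing can move, all squares are 1 and the factor of \<open>\<beta>\<close>
  vanishes, so only the energy is left.\<close>

lemma walk_inv_final:
  assumes "walk_inv m n a \<epsilon> B {} M x"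
  shows "\<forall>l<n. x l \<in> {-1, 1}" and "energy m a {..<n} x \<le> B * harmonic n"
proof -
  show x: "\<forall>l<n. x l \<in> {-1, 1}" using assms unfolding walk_inv_def by auto
  then have "(\<Sum>l<n. (x l)\<^sup>2) = (\<Sum>l<n. 1)" by (intro sum.cong) auto
  then show "energy m a {..<n} x \<le> B * harmonic n"
    using assms unfolding walk_inv_def by (auto simp: harmonic_def)
qed

text \<open>The time at which coordinate \<open>l\<close>, moving from \<open>x l\<close> with
  velocity \<open>u l\<close>, reaches the end of \<open>[-1, 1]\<close> ahead of it. At velocity 0
  the value is 0, hence the guards \<open>u l \<noteq> 0\<close> in what follows.\<close>

definition max_step :: "(nat \<Rightarrow> real) \<Rightarrow> (nat \<Rightarrow> real) \<Rightarrow> nat \<Rightarrow> real" where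
  "max_step x u l = ((if 0 < u l then 1 else -1) - x l) / u l"

lemma max_step_nonneg: "\<bar>x l\<bar> \<le> 1 \<Longrightarrow> max_step x u l \<ge> 0"
  unfolding max_step_def by (auto simp: divide_nonneg_nonneg divide_nonpos_nonpos)

text \<open>The interval has length 2. This justifies the value with which the line search
  starts.\<close>

lemma max_step_le: "\<bar>x l\<bar> \<le> 1 \<Longrightarrow> u l \<noteq> 0 \<Longrightarrow> max_step x u l \<le> 2 / \<bar>u l\<bar>"
proof -
  assume "\<bar>x l\<bar> \<le> 1" "u l \<noteq> 0"
  then have "\<bar>max_step x u l\<bar> \<le> 2 / \<bar>u l\<bar>"
    unfolding max_step_def abs_divide by (intro divide_right_mono) auto
  then show ?thesis by linarith
qed

lemma max_step_bounded:
  assumes "\<bar>x l\<bar> \<le> 1" and "0 \<le> \<alpha>" and "u l \<noteq> 0 \<Longrightarrow> \<alpha> \<le> max_step x u l"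
  shows "\<bar>x l + \<alpha> * u l\<bar> \<le> 1"
proof -
  consider "u l = 0" | "u l > 0" | "u l < 0" by linarith
  then show ?thesis
  proof cases
    case 2
    then have "\<alpha> * u l \<le> 1 - x l" using assms(3) unfolding max_step_def by (simp add: field_simps)
    moreover have "\<alpha> * u l \<ge> 0" using 2 assms(2) by simp
    ultimately show ?thesis using assms(1) by linarith
  next
    case 3
    then have "\<alpha> * u l \<ge> -1 - x l" using assms(3) unfolding max_step_def by (simp add: field_simps)
    moreover have "\<alpha> * u l \<le> 0" using 3 assms(2) by (simp add: mult_nonneg_nonpos)
    ultimately show ?thesis using assms(1) by linarith
  qed (use assms in auto)
qed

lemma max_step_hits: "u l \<noteq> 0 \<Longrightarrow> x l + max_step x u l * u l \<in> {-1, 1}"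
  unfolding max_step_def by auto

text \<open>The new witness is \<open>1 / M p p\<close>, which is at least the old
  \<open>\<beta>\<close> because \<open>\<beta> * M p p \<le> 1\<close>. Raising
  \<open>\<beta>\<close> lowers the potential, the move does not increase it, and freezing
  \<open>f\<close> costs at most \<open>B / card J\<close>, exactly the increment of the harmonic
  bound.\<close>

lemma walk_inv_step:
  assumes W: "walk_inv m n a \<epsilon> B J M x" and "\<epsilon> > 0" and "J \<noteq> {}"
    and H: "herdisc_bound m n a H" and B: "B = disc_const * (H + \<epsilon> * real n)"
    and p: "p < n" and max: "\<And>l. l < n \<Longrightarrow> M l l \<le> M p p"
    and sign: "g * (M p p * (\<Sum>r<m. (\<Sum>l<n. a r l * x l) * (\<Sum>l<n. a r l * M l p)) - (\<Sum>l<n. x l * M l p)) \<le> 0"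
    and u: "\<And>l. l < n \<Longrightarrow> u l = g * M l p"
    and f: "f < n" "u f \<noteq> 0"
    and step: "\<alpha> = max_step x u f" "\<And>l. l < n \<Longrightarrow> u l \<noteq> 0 \<Longrightarrow> \<alpha> \<le> max_step x u l"
    and x': "\<And>l. l < n \<Longrightarrow> x' l = x l + \<alpha> * u l"
    and M': "\<And>i l. i < n \<Longrightarrow> l < n \<Longrightarrow> M' i l = M i l - M i f * M l f / M f f"
  shows "f \<in> J" and "walk_inv m n a \<epsilon> B (J - {f}) M' x'"
proof -
  have M: "inverse_on n J (gram m a \<epsilon>) M" and x1: "\<And>l. l < n \<Longrightarrow> \<bar>x l\<bar> \<le> 1"
    and xJ: "\<And>l. l < n \<Longrightarrow> l \<notin> J \<Longrightarrow> x l \<in> {-1, 1}"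
    using W unfolding walk_inv_def by auto
  from W obtain \<beta> where \<beta>: "\<beta> \<ge> 0" "\<And>l. l < n \<Longrightarrow> \<beta> * M l l \<le> 1"
    and pot: "energy m a {..<n} x + \<beta> * (real n - (\<Sum>l<n. (x l)\<^sup>2) - real (card J)) \<le> B * (harmonic n - harmonic (card J))"
    unfolding walk_inv_def by auto
  have fin: "finite J" using M by (rule inverse_on_finite)
  have J: "J \<subseteq> {..<n}" and z: "\<And>i l. i < n \<Longrightarrow> l < n \<Longrightarrow> i \<notin> J \<Longrightarrow> M i l = 0"
    using M unfolding inverse_on_def by auto
  \<comment> \<open>Diagonal entries are positive on \<open>J\<close> and zero outside, so a maximal
    one lies in \<open>J\<close>.\<close>
  have pJ: "p \<in> J"
  proof (rule ccontr)
    assume "p \<notin> J"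
    obtain j where "j \<in> J" using \<open>J \<noteq> {}\<close> by auto
    then have "0 < M j j" "M j j \<le> M p p"
      using inverse_on_diag_pos[OF M _ \<open>\<epsilon> > 0\<close>] max J by auto
    then show False using z[OF p p \<open>p \<notin> J\<close>] by simp
  qed
  have pos: "M p p > 0" using inverse_on_diag_pos[OF M pJ \<open>\<epsilon> > 0\<close>] .
  show fJ: "f \<in> J" using f u z[OF f(1) p] by auto
  have u0: "u l = 0" if "l < n" "l \<notin> J" for l using u z p that by simp
  have \<alpha>0: "\<alpha> \<ge> 0" using step(1) max_step_nonneg x1 f(1) by simp
  have M'inv: "inverse_on n (J - {f}) (gram m a \<epsilon>) M'"
    using inverse_on_remove[OF M fJ \<open>\<epsilon> > 0\<close> M'] .
  have x'1: "\<bar>x' l\<bar> \<le> 1" if "l < n" for l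
    using max_step_bounded[of x l \<alpha> u] x1 x' step(2) \<alpha>0 that by simp
  have x'J: "x' l \<in> {-1, 1}" if "l < n" "l \<notin> J - {f}" for l
    using max_step_hits[of u f x] f step(1) x' that xJ[of l] u0[of l] by (cases "l = f") auto
  define \<beta>' where "\<beta>' = 1 / M p p"
  have \<beta>'0: "\<beta>' \<ge> 0" unfolding \<beta>'_def using pos by simp
  have le: "\<beta> \<le> \<beta>'" using \<beta>(2)[OF p] pos unfolding \<beta>'_def by (simp add: field_simps)
  \<comment> \<open>The update subtracts \<open>(M l f)\<^sup>2 / M f f\<close> from the diagonal,
    so the entries stay below the old maximum.\<close>
  have diag: "\<beta>' * M' l l \<le> 1" if "l < n" for l
  proof -
    have "M' l l \<le> M l l"
      using M'[OF that that] inverse_on_diag_pos[OF M fJ \<open>\<epsilon> > 0\<close>] by simp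
    also have "\<dots> \<le> M p p" using max that by simp
    finally show ?thesis unfolding \<beta>'_def using pos by (simp add: field_simps)
  qed
  define k where "k = card (J - {f})"
  have k: "card J = Suc k" unfolding k_def using fin fJ by (metis card_Suc_Diff1)
  have sq: "(x l)\<^sup>2 = 1" if "l < n" "l \<notin> J" for l using xJ[OF that] by auto
  \<comment> \<open>Frozen coordinates contribute 0 and each of the others at most 1, so the factor
    of \<open>\<beta>\<close> is nonpositive.\<close>
  have "real n - (\<Sum>l<n. (x l)\<^sup>2) = (\<Sum>l<n. 1 - (x l)\<^sup>2)" by (simp add: sum_subtractf)
  also have "\<dots> = (\<Sum>l\<in>J. 1 - (x l)\<^sup>2)"
    using J sq by (intro sum.mono_neutral_right) auto
  also have "\<dots> \<le> (\<Sum>l\<in>J. 1)" by (intro sum_mono) auto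
  finally have L: "real n - (\<Sum>l<n. (x l)\<^sup>2) - real (card J) \<le> 0" by simp
  have "energy m a {..<n} x' - energy m a {..<n} x \<le> ((\<Sum>l<n. (x' l)\<^sup>2) - (\<Sum>l<n. (x l)\<^sup>2)) / M p p"
  proof (rule energy_step[OF M \<open>\<epsilon> > 0\<close> pJ, where t = "\<alpha> * g"])
    show "x' l = x l + \<alpha> * g * M l p" if "l < n" for l using x' u that by simp
    show "\<alpha> * g * (M p p * (\<Sum>r<m. (\<Sum>l<n. a r l * x l) * (\<Sum>l<n. a r l * M l p)) - (\<Sum>l<n. x l * M l p)) \<le> 0"
      using mult_nonneg_nonpos[OF \<alpha>0 sign] by (simp only: mult.assoc)
  qed
  then have "energy m a {..<n} x' + \<beta>' * (real n - (\<Sum>l<n. (x' l)\<^sup>2) - real k)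
      \<le> energy m a {..<n} x + \<beta>' * (real n - (\<Sum>l<n. (x l)\<^sup>2) - real (card J)) + \<beta>'"
    unfolding k \<beta>'_def by (simp add: diff_divide_distrib add_divide_distrib)
  also have "\<dots> \<le> energy m a {..<n} x + \<beta> * (real n - (\<Sum>l<n. (x l)\<^sup>2) - real (card J)) + \<beta>'"
    using mult_right_mono_neg[OF le L] by simp
  also have "\<dots> \<le> B * (harmonic n - harmonic (card J)) + B / real (card J)"
    using pot max_diag_bound[OF M \<open>\<epsilon> > 0\<close> pJ max H] unfolding \<beta>'_def B by simp
  also have "\<dots> = B * (harmonic n - harmonic k)"
    unfolding k harmonic_Suc by (simp add: divide_inverse algebra_simps)
  finally show "walk_inv m n a \<epsilon> B (J - {f}) M' x'"
    unfolding walk_inv_def using M'inv x'1 x'J diag \<beta>'0 k_def by blast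
qed

text \<open>From \<open>n \<ge> 2\<close> on, both 1 and \<open>ln n\<close> are at most
  \<open>log 2 n\<close>.\<close>

lemma harmonic_le_log:
  assumes "n \<ge> 2"
  shows "harmonic n \<le> 2 * log 2 (real n)"
proof -
  have "harmonic n \<le> 1 + ln (real n)"
    using harmonic_le_ln assms by simp
  moreover have "1 \<le> log 2 (real n)" using assms by simp
  moreover have "ln (real n) \<le> log 2 (real n)"
  proof -
    have "ln (real n) = log 2 (real n) * ln 2" by (simp add: log_def)
    also have "\<dots> \<le> log 2 (real n) * 1"
      using assms ln_le_minus_one[of 2] by (intro mult_left_mono) auto
    finally show ?thesis by simp
  qed
  ultimately show ?thesis by linarith
qed

section \<open>Timed total correctness with frame conditions\<close>

section \<open>Program logic\<close>

text \<open>Termination, time bound and postcondition for one fixed initial memory, so that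
  postconditions can refer to that memory directly.\<close>

definition runs :: "com \<Rightarrow> mem \<Rightarrow> nat \<Rightarrow> (mem \<Rightarrow> bool) \<Rightarrow> bool" where
  "runs c s T Q \<longleftrightarrow> (\<exists>t s'. exec c s t s' \<and> t \<le> T \<and> Q s')"

text \<open>A syntactic over-approximation in units of whole arrays; it carries facts about all
  other arrays across a command.\<close>

primrec nwrites :: "com \<Rightarrow> vname set" where
  "nwrites Skip = {}"
| "nwrites (NStore a e f) = {a}"
| "nwrites (RStore a e f) = {}"
| "nwrites (Then c d) = nwrites c \<union> nwrites d"
| "nwrites (Cond b c d) = nwrites c \<union> nwrites d"
| "nwrites (Loop b c) = nwrites c"

primrec rwrites :: "com \<Rightarrow> vname set" where
  "rwrites Skip = {}"
| "rwrites (NStore a e f) = {}"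
| "rwrites (RStore a e f) = {a}"
| "rwrites (Then c d) = rwrites c \<union> rwrites d"
| "rwrites (Cond b c d) = rwrites c \<union> rwrites d"
| "rwrites (Loop b c) = rwrites c"

definition same_except :: "vname set \<Rightarrow> vname set \<Rightarrow> mem \<Rightarrow> mem \<Rightarrow> bool" where
  "same_except N R s s' \<longleftrightarrow> (\<forall>a. a \<notin> N \<longrightarrow> ncell s' a = ncell s a) \<and> (\<forall>a. a \<notin> R \<longrightarrow> rcell s' a = rcell s a)"

lemma same_except_ncell: "same_except N R s s' \<Longrightarrow> a \<notin> N \<Longrightarrow> ncell s' a = ncell s a"
  unfolding same_except_def by blast

lemma same_except_refl: "same_except N R s s"
  unfolding same_except_def by simp

lemma same_except_trans:
  "same_except N R s s' \<Longrightarrow> same_except N R s' s'' \<Longrightarrow> same_except N R s s''"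
  unfolding same_except_def by simp

lemma cell_store [simp]:
  "ncell (nstore a i v s) = (ncell s)(a := (ncell s a)(i := v))"
  "rcell (nstore a i v s) = rcell s"
  "ncell (rstore a i w s) = ncell s"
  "rcell (rstore a i w s) = (rcell s)(a := (rcell s a)(i := w))"
  unfolding nstore_def rstore_def by simp_all

lemma exec_same_except:
  "exec c s t s' \<Longrightarrow> same_except (nwrites c) (rwrites c) s s'"
proof (induction rule: exec.induct)
  case (Then c s t s' d u s'')
  then show ?case by (simp add: same_except_def)
next
  case (LoopTrue s b c t s' u s'')
  then show ?case by (simp add: same_except_def)
qed (simp_all add: same_except_def)

lemma runs_Skip: "Q s \<Longrightarrow> 1 \<le> T \<Longrightarrow> runs Skip s T Q"
  unfolding runs_def using exec.Skip by blast

lemma runs_NStore: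
  "Q (nstore a (nval s e) (nval s f) s) \<Longrightarrow> 1 + ncost e + ncost f \<le> T \<Longrightarrow> runs (NStore a e f) s T Q"
  unfolding runs_def using exec.NStore by blast

lemma runs_RStore:
  "Q (rstore a (nval s e) (rval s f) s) \<Longrightarrow> 1 + ncost e + rcost f \<le> T \<Longrightarrow> runs (RStore a e f) s T Q"
  unfolding runs_def using exec.RStore by blast

text \<open>The intermediate assertion only has to describe what \<open>c\<close> computes; the rest
  of the state is recovered from the frame.\<close>

lemma runs_Then:
  assumes "runs c s T1 P"
    and "\<And>s'. P s' \<Longrightarrow> same_except (nwrites c) (rwrites c) s s' \<Longrightarrow> runs d s' T2 Q"
    and "T1 + T2 \<le> T"
  shows "runs (Then c d) s T Q"
proof -
  obtain t s' where 1: "exec c s t s'" "t \<le> T1" "P s'" using assms(1) unfolding runs_def by blast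
  with assms(2) exec_same_except obtain u s'' where 2: "exec d s' u s''" "u \<le> T2" "Q s''"
    unfolding runs_def by blast
  have "exec (Then c d) s (t + u) s''" using 1 2 by (blast intro: exec.Then)
  then show ?thesis unfolding runs_def using 1 2 assms(3) by (meson add_mono le_trans)
qed

lemma runs_Cond:
  assumes "bval s b \<Longrightarrow> runs c s T Q" and "\<not> bval s b \<Longrightarrow> runs d s T Q" and "1 + bcost b + T \<le> T'"
  shows "runs (Cond b c d) s T' Q"
proof (cases "bval s b")
  case True
  then obtain t s' where "exec c s t s'" "t \<le> T" "Q s'" using assms(1) unfolding runs_def by blast
  then show ?thesis unfolding runs_def using True assms(3)
    by (intro exI[of _ "1 + bcost b + t"] exI[of _ s'] conjI exec.CondTrue) auto
next
  case False
  then obtain t s' where "exec d s t s'" "t \<le> T" "Q s'" using assms(2) unfolding runs_def by blast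
  then show ?thesis unfolding runs_def using False assms(3)
    by (intro exI[of _ "1 + bcost b + t"] exI[of _ s'] conjI exec.CondFalse) auto
qed

lemma runs_conseq:
  assumes "runs c s T P" and "\<And>s'. P s' \<Longrightarrow> same_except (nwrites c) (rwrites c) s s' \<Longrightarrow> Q s'" and "T \<le> T'"
  shows "runs c s T' Q"
  using assms exec_same_except unfolding runs_def by (meson le_trans)

abbreviation NVar :: "vname \<Rightarrow> nexp" where "NVar a \<equiv> NCell a (NConst 0)"
abbreviation RVar :: "vname \<Rightarrow> rexp" where "RVar a \<equiv> RCell a (NConst 0)"

definition For :: "vname \<Rightarrow> vname \<Rightarrow> com \<Rightarrow> com" where
  "For i b c = Then (NStore i (NConst 0) (NConst 0))
     (Loop (NLess (NVar i) (NVar b)) (Then c (NStore i (NConst 0) (NAdd (NVar i) (NConst 1)))))"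

lemma writes_For [simp]: "nwrites (For i b c) = insert i (nwrites c)" "rwrites (For i b c) = rwrites c"
  unfolding For_def by auto

text \<open>\<open>I k\<close> holds before pass \<open>k\<close> and \<open>I' k\<close> after its
  body; \<open>shift\<close> carries the latter across the increment of the counter. A pass pays 12
  units besides the body, 6 for the test and 6 for the increment; the additional 9 are the
  initialization and the failing test.\<close>

lemma runs_For:
  assumes i: "i \<noteq> b" "i \<notin> nwrites c" "b \<notin> nwrites c"
    and N: "ncell s b 0 = N"
    and init: "\<And>s'. same_except {i} {} s s' \<Longrightarrow> I 0 s'"
    and step: "\<And>k s'. k < N \<Longrightarrow> I k s' \<Longrightarrow> ncell s' i 0 = k \<Longrightarrow>
       same_except (insert i (nwrites c)) (rwrites c) s s' \<Longrightarrow> runs c s' T (I' k)"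
    and shift: "\<And>k s' s''. k < N \<Longrightarrow> I' k s' \<Longrightarrow> same_except (insert i (nwrites c)) (rwrites c) s s' \<Longrightarrow>
       same_except {i} {} s' s'' \<Longrightarrow> ncell s'' i 0 = Suc k \<Longrightarrow> I (Suc k) s''"
    and T': "N * (T + 12) + 9 \<le> T'"
  shows "runs (For i b c) s T' (I N)"
proof -
  let ?same = "same_except (insert i (nwrites c)) (rwrites c)"
  let ?c = "Then c (NStore i (NConst 0) (NAdd (NVar i) (NConst 1)))"
  let ?L = "Loop (NLess (NVar i) (NVar b)) ?c"
  have loop: "runs ?L s' ((N - k) * (T + 12) + 6) (I N)"
    if "k \<le> N" "I k s'" "ncell s' i 0 = k" "?same s s'" for k s'
    using that
  proof (induction k arbitrary: s' rule: inc_induct)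
    case base
    have "ncell s' b 0 = N" using base.prems N i same_except_ncell[of _ _ s s' b] by auto
    then have "\<not> bval s' (NLess (NVar i) (NVar b))" using base.prems by simp
    then show ?case unfolding runs_def using base.prems
      by (intro exI[of _ "1 + bcost (NLess (NVar i) (NVar b))"] exI[of _ s'] conjI exec.LoopFalse) auto
  next
    case (step k)
    have "ncell s' b 0 = N" using step.prems N i same_except_ncell[of _ _ s s' b] by auto
    then have b: "bval s' (NLess (NVar i) (NVar b))" using step by simp
    obtain t r where r: "exec c s' t r" "t \<le> T" "I' k r"
      using assms(6)[OF step.hyps(2) step.prems] unfolding runs_def by blast
    have rk: "ncell r i 0 = k"
      using exec_same_except[OF r(1)] i step.prems(2) by (simp add: same_except_def)
    have sr: "?same s r"
      using step.prems(3) exec_same_except[OF r(1)] by (auto simp: same_except_def)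
    define r' where "r' = nstore i 0 (Suc k) r"
    have "I (Suc k) r'"
      by (rule shift[OF step.hyps(2) r(3) sr]) (auto simp: r'_def same_except_def)
    moreover have "ncell r' i 0 = Suc k" "?same s r'"
      using sr by (auto simp: r'_def same_except_def)
    ultimately obtain u s'' where u: "exec ?L r' u s''" "u \<le> (N - Suc k) * (T + 12) + 6" "I N s''"
      using step.IH unfolding runs_def by blast
    have "exec (NStore i (NConst 0) (NAdd (NVar i) (NConst 1))) r 6 r'"
      using exec.NStore[of i "NConst 0" "NAdd (NVar i) (NConst 1)" r] rk unfolding r'_def by (simp add: numeral_eq_Suc)
    then have "exec ?c s' (t + 6) r'" using r(1) exec.Then by blast
    then have "exec ?L s' (1 + bcost (NLess (NVar i) (NVar b)) + (t + 6) + u) s''"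
      by (rule exec.LoopTrue[OF b _ u(1)])
    moreover have "1 + bcost (NLess (NVar i) (NVar b)) + (t + 6) + u \<le> (N - k) * (T + 12) + 6"
      using r(2) u(2) step.hyps(2) by (simp add: Suc_diff_Suc[symmetric])
    ultimately show ?case unfolding runs_def using u(3) by blast
  qed
  show ?thesis
    unfolding For_def
  proof (rule runs_Then)
    show "runs (NStore i (NConst 0) (NConst 0)) s 3 (\<lambda>s'. s' = nstore i 0 0 s)"
      by (rule runs_NStore) auto
    fix s' assume "s' = nstore i 0 0 s"
    then show "runs ?L s' (N * (T + 12) + 6) (I N)"
      using loop[of 0 s'] init[of s'] by (simp add: same_except_def)
  qed (use T' in auto)
qed

definition SumInto :: "vname \<Rightarrow> nexp \<Rightarrow> vname \<Rightarrow> vname \<Rightarrow> rexp \<Rightarrow> com" where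
  "SumInto a e q b f = Then (RStore a e (RNat (NConst 0))) (For q b (RStore a e (RAdd (RCell a e) f)))"

lemma writes_SumInto [simp]: "nwrites (SumInto a e q b f) = {q}" "rwrites (SumInto a e q b f) = {a}"
  unfolding SumInto_def by auto

text \<open>\<open>e\<close> and \<open>f\<close> are evaluated in arbitrary memories that differ
  from \<open>s\<close> only in the counter and the target array, so the value of \<open>f\<close>
  may depend on the counter but not on partial sums.\<close>

lemma runs_SumInto:
  assumes "q \<noteq> b" and N: "ncell s b 0 = N"
    and e: "\<And>s'. same_except {q} {a} s s' \<Longrightarrow> nval s' e = idx"
    and f: "\<And>k s'. k < N \<Longrightarrow> ncell s' q 0 = k \<Longrightarrow> same_except {q} {a} s s' \<Longrightarrow> rval s' f = g k"
    and T: "N * (2 * ncost e + rcost f + 15) + ncost e + 12 \<le> T"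
  shows "runs (SumInto a e q b f) s T (\<lambda>s'. rcell s' a = (rcell s a)(idx := \<Sum>k<N. g k))"
  unfolding SumInto_def
proof (rule runs_Then)
  show "runs (RStore a e (RNat (NConst 0))) s (ncost e + 3) (\<lambda>s'. s' = rstore a idx 0 s)"
    by (rule runs_RStore) (use e same_except_refl in auto)
  fix s1 assume "s1 = rstore a idx 0 s"
  then have s1: "same_except {q} {a} s s1" "rcell s1 a = (rcell s a)(idx := 0)"
    by (auto simp: same_except_def)
  show "runs (For q b (RStore a e (RAdd (RCell a e) f))) s1 (N * (2 * ncost e + rcost f + 15) + 9)
     (\<lambda>s'. rcell s' a = (rcell s a)(idx := \<Sum>k<N. g k))"
  proof (rule runs_For[where N = N and I = "\<lambda>k s'. rcell s' a = (rcell s a)(idx := \<Sum>j<k. g j)"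
        and I' = "\<lambda>k s'. rcell s' a = (rcell s a)(idx := \<Sum>j<Suc k. g j)" and T = "2 * ncost e + rcost f + 3"])
    show "ncell s1 b 0 = N" using s1 N \<open>q \<noteq> b\<close> by (simp add: same_except_def)
    show "rcell s' a = (rcell s a)(idx := \<Sum>j<0. g j)" if "same_except {q} {} s1 s'" for s'
      using that s1 by (simp add: same_except_def)
    show "runs (RStore a e (RAdd (RCell a e) f)) s' (2 * ncost e + rcost f + 3)
       (\<lambda>s'. rcell s' a = (rcell s a)(idx := \<Sum>j<Suc k. g j))"
      if "k < N" "rcell s' a = (rcell s a)(idx := \<Sum>j<k. g j)" "ncell s' q 0 = k"
        "same_except (insert q (nwrites (RStore a e (RAdd (RCell a e) f)))) (rwrites (RStore a e (RAdd (RCell a e) f))) s1 s'"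
      for k s'
    proof -
      have same: "same_except {q} {a} s s'" using that(4) s1 same_except_trans by auto
      show ?thesis
        by (rule runs_RStore) (use that(2) e[OF same] f[OF that(1,3) same] in auto)
    qed
    show "rcell s'' a = (rcell s a)(idx := \<Sum>j<Suc k. g j)"
      if "rcell s' a = (rcell s a)(idx := \<Sum>j<Suc k. g j)" "same_except {q} {} s' s''" for k s' s''
      using that by (simp add: same_except_def)
  qed (use \<open>q \<noteq> b\<close> in auto)
qed (use T in auto)

definition Fill :: "vname \<Rightarrow> vname \<Rightarrow> vname \<Rightarrow> rexp \<Rightarrow> com" where
  "Fill a q b f = For q b (RStore a (NVar q) f)"

lemma writes_Fill [simp]: "nwrites (Fill a q b f) = {q}" "rwrites (Fill a q b f) = {a}"
  unfolding Fill_def by auto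

text \<open>The expression may read the cell about to be overwritten, which still has its old value;
  this allows the update of \<open>x\<close> in place.\<close>

lemma runs_Fill:
  assumes "q \<noteq> b" and N: "ncell s b 0 = N"
    and f: "\<And>k s'. k < N \<Longrightarrow> ncell s' q 0 = k \<Longrightarrow> same_except {q} {a} s s' \<Longrightarrow>
      rcell s' a k = rcell s a k \<Longrightarrow> rval s' f = g k"
    and T: "N * (rcost f + 15) + 9 \<le> T"
  shows "runs (Fill a q b f) s T (\<lambda>s'. \<forall>k<N. rcell s' a k = g k)"
proof -
  let ?I = "\<lambda>k s'. \<forall>j. rcell s' a j = (if j < k then g j else rcell s a j)"
  have "runs (Fill a q b f) s T (?I N)"
    unfolding Fill_def
  proof (rule runs_For[where N = N and I = ?I and I' = "\<lambda>k. ?I (Suc k)" and T = "rcost f + 3"])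
    show "ncell s b 0 = N" using N .
    show "?I 0 s'" if "same_except {q} {} s s'" for s'
      using that by (simp add: same_except_def)
    show "runs (RStore a (NVar q) f) s' (rcost f + 3) (?I (Suc k))"
      if "k < N" "?I k s'" "ncell s' q 0 = k"
        "same_except (insert q (nwrites (RStore a (NVar q) f))) (rwrites (RStore a (NVar q) f)) s s'" for k s'
    proof -
      have "rval s' f = g k" by (rule f[OF that(1,3)]) (use that in auto)
      then show ?thesis by (intro runs_RStore) (use that in \<open>auto simp: less_Suc_eq\<close>)
    qed
    show "?I (Suc k) s''" if "?I (Suc k) s'" "same_except {q} {} s' s''" for k s' s''
      using that by (simp add: same_except_def)
  qed (use \<open>q \<noteq> b\<close> T in \<open>auto simp: ac_simps\<close>)
  then show ?thesis by (rule runs_conseq) auto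
qed

section \<open>The coloring algorithm as a real RAM program\<close>

section \<open>The program\<close>

definition entry :: "nat \<Rightarrow> mem \<Rightarrow> vname \<Rightarrow> nat \<Rightarrow> nat \<Rightarrow> real" where
  "entry n s a i l = rcell s a (i * n + l)"

lemma row_major_inj:
  fixes i l i' l' n :: nat
  assumes "l < n" "l' < n"
  shows "i * n + l = i' * n + l' \<longleftrightarrow> i = i' \<and> l = l'"
proof
  assume eq: "i * n + l = i' * n + l'"
  have "(i * n + l) div n = i" "(i' * n + l') div n = i'" using assms by auto
  with eq show "i = i' \<and> l = l'" by auto
qed simp

lemma entry_upd:
  "l < n \<Longrightarrow> l' < n \<Longrightarrow> rcell s a = (rcell s0 a)(i * n + l := v) \<Longrightarrow>
    entry n s a i' l' = (if i' = i \<and> l' = l then v else entry n s0 a i' l')"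
  unfolding entry_def using row_major_inj[of l' n l i' i] by auto

abbreviation Index :: "vname \<Rightarrow> vname \<Rightarrow> nexp" where
  "Index i l \<equiv> NAdd (NMul (NVar i) (NVar ''n'')) (NVar l)"

abbreviation REntry :: "vname \<Rightarrow> vname \<Rightarrow> vname \<Rightarrow> rexp" where
  "REntry a i l \<equiv> RCell a (Index i l)"

abbreviation RElem :: "vname \<Rightarrow> vname \<Rightarrow> rexp" where
  "RElem a l \<equiv> RCell a (NVar l)"

text \<open>Shared by both updates of the inverse: \<open>s\<close> is
  \<open>1 + a\<^sup>T u\<close> when a row \<open>a\<close> is added, and \<open>M f f\<close>,
  with column \<open>f\<close> in \<open>u\<close>, when \<open>f\<close> is frozen. Having
  \<open>u\<close> and \<open>s\<close> outside \<open>M\<close> makes overwriting in place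
  safe.\<close>

definition RankOne :: com where
  "RankOne = For ''l'' ''n'' (For ''q'' ''n'' (RStore ''M'' (Index ''l'' ''q'')
     (RSub (REntry ''M'' ''l'' ''q'') (RDiv (RMul (RElem ''u'' ''l'') (RElem ''u'' ''q'')) (RVar ''s'')))))"

definition AddRow :: com where
  "AddRow =
     Then (For ''l'' ''n'' (SumInto ''u'' (NVar ''l'') ''q'' ''n'' (RMul (REntry ''M'' ''l'' ''q'') (REntry ''A'' ''i'' ''q''))))
    (Then (SumInto ''s'' (NConst 0) ''l'' ''n'' (RMul (REntry ''A'' ''i'' ''l'') (RElem ''u'' ''l'')))
    (Then (RStore ''s'' (NConst 0) (RAdd (RNat (NConst 1)) (RVar ''s'')))
          RankOne))"

text \<open>The inverse starts as \<open>\<epsilon>\<^sup>-\<^sup>1 I\<close> with \<open>\<epsilon> = tr (A\<^sup>T A) / n\<^sup>2\<close>; for \<open>A = 0\<close>, where this would vanish,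
  \<open>\<epsilon> = 1\<close>.\<close>

definition Setup :: com where
  "Setup =
     Then (NStore ''k'' (NConst 0) (NMul (NVar ''m'') (NVar ''n'')))
    (Then (SumInto ''t'' (NConst 0) ''l'' ''k'' (RMul (RElem ''A'' ''l'') (RElem ''A'' ''l'')))
    (Then (Cond (RLess (RNat (NConst 0)) (RVar ''t''))
            (RStore ''t'' (NConst 0) (RDiv (RNat (NMul (NVar ''n'') (NVar ''n''))) (RVar ''t'')))
            (RStore ''t'' (NConst 0) (RNat (NConst 1))))
          (For ''l'' ''n'' (RStore ''M'' (Index ''l'' ''l'') (RVar ''t'')))))"

text \<open>The set \<open>J\<close> is not stored: the zero padding of \<open>M\<close> makes
  frozen coordinates lose against any that can still move.\<close>

definition Select :: com where
  "Select = Then (NStore ''p'' (NConst 0) (NConst 0))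
    (For ''l'' ''n'' (Cond (RLess (REntry ''M'' ''p'' ''p'') (REntry ''M'' ''l'' ''l''))
       (NStore ''p'' (NConst 0) (NVar ''l'')) Skip))"

text \<open>The inner product of \<open>A x\<close> with the image of column \<open>p\<close> of
  \<open>M\<close>, half the linear coefficient of the energy. Going through the rows of
  \<open>A\<close> keeps the cost at \<open>O(m n)\<close>.\<close>

definition Correlate :: com where
  "Correlate = Then (RStore ''c'' (NConst 0) (RNat (NConst 0)))
    (For ''i'' ''m''
      (Then (SumInto ''y'' (NConst 0) ''l'' ''n'' (RMul (REntry ''A'' ''i'' ''l'') (RElem ''x'' ''l'')))
      (Then (SumInto ''w'' (NConst 0) ''l'' ''n'' (RMul (REntry ''A'' ''i'' ''l'') (REntry ''M'' ''l'' ''p'')))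
            (RStore ''c'' (NConst 0) (RAdd (RVar ''c'') (RMul (RVar ''y'') (RVar ''w'')))))))"

text \<open>The initial value \<open>2 / M p p\<close> is at least the admissible step for coordinate \<open>p\<close>, because
  \<open>\<bar>u p\<bar> = M p p\<close>.\<close>

definition LineSearch :: com where
  "LineSearch =
     Then (RStore ''a'' (NConst 0) (RDiv (RNat (NConst 2)) (REntry ''M'' ''p'' ''p'')))
    (Then (NStore ''f'' (NConst 0) (NVar ''p''))
    (For ''l'' ''n''
      (Then (Cond (RLess (RNat (NConst 0)) (RElem ''u'' ''l''))
              (RStore ''b'' (NConst 0) (RDiv (RSub (RNat (NConst 1)) (RElem ''x'' ''l'')) (RElem ''u'' ''l'')))
              (Cond (RLess (RElem ''u'' ''l'') (RNat (NConst 0)))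
                (RStore ''b'' (NConst 0)
                  (RDiv (RSub (RSub (RNat (NConst 0)) (RNat (NConst 1))) (RElem ''x'' ''l'')) (RElem ''u'' ''l'')))
                (RStore ''b'' (NConst 0) (RVar ''a''))))
            (Cond (RLess (RVar ''b'') (RVar ''a''))
              (Then (RStore ''a'' (NConst 0) (RVar ''b'')) (NStore ''f'' (NConst 0) (NVar ''l'')))
              Skip))))"

text \<open>The array \<open>u\<close> serves twice, first as the direction of the move and then as
  column \<open>f\<close> for the rank one update.\<close>

definition WalkStep :: com where
  "WalkStep =
     Then Select
    (Then Correlate
    (Then (SumInto ''e'' (NConst 0) ''l'' ''n'' (RMul (RElem ''x'' ''l'') (REntry ''M'' ''l'' ''p'')))
    (Then (Cond (RLess (RVar ''e'') (RMul (REntry ''M'' ''p'' ''p'') (RVar ''c'')))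
            (RStore ''g'' (NConst 0) (RSub (RNat (NConst 0)) (RNat (NConst 1))))
            (RStore ''g'' (NConst 0) (RNat (NConst 1))))
    (Then (Fill ''u'' ''l'' ''n'' (RMul (RVar ''g'') (REntry ''M'' ''l'' ''p'')))
    (Then LineSearch
    (Then (Fill ''x'' ''l'' ''n'' (RAdd (RElem ''x'' ''l'') (RMul (RVar ''a'') (RElem ''u'' ''l''))))
    (Then (Fill ''u'' ''l'' ''n'' (REntry ''M'' ''l'' ''f''))
    (Then (RStore ''s'' (NConst 0) (REntry ''M'' ''f'' ''f''))
          RankOne))))))))"

text \<open>\<open>m\<close> row updates of cost \<open>O(n^2)\<close> are followed by
  \<open>n\<close> walk steps of cost \<open>O((m + n) n)\<close>, each of which freezes one
  coordinate.\<close>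

definition Program :: com where
  "Program = Then Setup (Then (For ''i'' ''m'' AddRow) (For ''h'' ''n'' WalkStep))"

section \<open>Arrays written by the subprograms\<close>

lemma writes_RankOne [simp]: "nwrites RankOne = {''l'', ''q''}" "rwrites RankOne = {''M''}"
  unfolding RankOne_def by auto

lemma writes_AddRow [simp]: "nwrites AddRow = {''l'', ''q''}" "rwrites AddRow = {''M'', ''u'', ''s''}"
  unfolding AddRow_def by auto

lemma writes_Setup [simp]: "nwrites Setup = {''k'', ''l''}" "rwrites Setup = {''M'', ''t''}"
  unfolding Setup_def by auto

lemma writes_Select [simp]: "nwrites Select = {''p'', ''l''}" "rwrites Select = {}"
  unfolding Select_def by auto

lemma writes_Correlate [simp]: "nwrites Correlate = {''i'', ''l''}" "rwrites Correlate = {''c'', ''y'', ''w''}"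
  unfolding Correlate_def by auto

lemma writes_LineSearch [simp]: "nwrites LineSearch = {''f'', ''l''}" "rwrites LineSearch = {''a'', ''b''}"
  unfolding LineSearch_def by auto

lemma writes_WalkStep [simp]:
  "nwrites WalkStep = {''p'', ''i'', ''l'', ''f'', ''q''}"
  "rwrites WalkStep = {''c'', ''y'', ''w'', ''e'', ''g'', ''u'', ''a'', ''b'', ''x'', ''s'', ''M''}"
  unfolding WalkStep_def by auto

section \<open>Correctness and running time of the subprograms\<close>

lemma runs_RankOne:
  assumes n: "ncell s ''n'' 0 = n" and T: "n * (n * 41 + 21) + 9 \<le> T"
  shows "runs RankOne s T (\<lambda>s'. \<forall>i<n. \<forall>l<n. entry n s' ''M'' i l =
    entry n s ''M'' i l - rcell s ''u'' i * rcell s ''u'' l / rcell s ''s'' 0)"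
proof -
  define new where "new i l = entry n s ''M'' i l - rcell s ''u'' i * rcell s ''u'' l / rcell s ''s'' 0" for i l
  let ?I = "\<lambda>k s'. \<forall>i<n. \<forall>l<n. entry n s' ''M'' i l = (if i < k then new i l else entry n s ''M'' i l)"
  \<comment> \<open>The state inside row \<open>i0\<close>: earlier rows are finished, and so are
    the first \<open>k\<close> entries of this row.\<close>
  let ?K = "\<lambda>i0 k s'. \<forall>i<n. \<forall>l<n. entry n s' ''M'' i l =
     (if i < i0 \<or> i = i0 \<and> l < k then new i l else entry n s ''M'' i l)"
  have "runs RankOne s T (?I n)"
    unfolding RankOne_def
  proof (rule runs_For[where I = ?I and I' = "\<lambda>k. ?I (Suc k)" and N = n and T = "n * 41 + 9"])
    show "?I 0 s'" if "same_except {''l''} {} s s'" for s'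
      using that by (simp add: same_except_def entry_def)
    show "?I (Suc k) s''" if "?I (Suc k) s'" "same_except {''l''} {} s' s''" for k s' s''
      using that by (simp add: same_except_def entry_def)
    fix i0 s1
    assume i0: "i0 < n" and I: "?I i0 s1" and l: "ncell s1 ''l'' 0 = i0"
      and s1: "same_except (insert ''l'' (nwrites (For ''q'' ''n'' (RStore ''M'' (Index ''l'' ''q'')
         (RSub (REntry ''M'' ''l'' ''q'') (RDiv (RMul (RElem ''u'' ''l'') (RElem ''u'' ''q'')) (RVar ''s'')))))))
       (rwrites (For ''q'' ''n'' (RStore ''M'' (Index ''l'' ''q'')
         (RSub (REntry ''M'' ''l'' ''q'') (RDiv (RMul (RElem ''u'' ''l'') (RElem ''u'' ''q'')) (RVar ''s'')))))) s s1"
    have "runs (For ''q'' ''n'' (RStore ''M'' (Index ''l'' ''q'')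
         (RSub (REntry ''M'' ''l'' ''q'') (RDiv (RMul (RElem ''u'' ''l'') (RElem ''u'' ''q'')) (RVar ''s''))))) s1 (n * 41 + 9) (?K i0 n)"
    proof (rule runs_For[where I = "?K i0" and I' = "\<lambda>k. ?K i0 (Suc k)" and N = n and T = 29])
      show "ncell s1 ''n'' 0 = n" using s1 n by (simp add: same_except_def)
      show "?K i0 0 s'" if "same_except {''q''} {} s1 s'" for s'
        using that I by (simp add: same_except_def entry_def)
      show "?K i0 (Suc k) s''" if "?K i0 (Suc k) s'" "same_except {''q''} {} s' s''" for k s' s''
        using that by (simp add: same_except_def entry_def)
      fix k s2
      assume k: "k < n" and K: "?K i0 k s2" and q: "ncell s2 ''q'' 0 = k"
        and s2: "same_except (insert ''q'' (nwrites (RStore ''M'' (Index ''l'' ''q'')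
         (RSub (REntry ''M'' ''l'' ''q'') (RDiv (RMul (RElem ''u'' ''l'') (RElem ''u'' ''q'')) (RVar ''s''))))))
          (rwrites (RStore ''M'' (Index ''l'' ''q'')
         (RSub (REntry ''M'' ''l'' ''q'') (RDiv (RMul (RElem ''u'' ''l'') (RElem ''u'' ''q'')) (RVar ''s''))))) s1 s2"
      have cells: "ncell s2 ''n'' 0 = n" "ncell s2 ''l'' 0 = i0" "rcell s2 ''u'' = rcell s ''u''" "rcell s2 ''s'' = rcell s ''s''"
        using s1 s2 n l by (simp_all add: same_except_def)
      have old: "rcell s2 ''M'' (i0 * n + k) = entry n s ''M'' i0 k"
        using K i0 k by (auto simp: entry_def)
      show "runs (RStore ''M'' (Index ''l'' ''q'')
         (RSub (REntry ''M'' ''l'' ''q'') (RDiv (RMul (RElem ''u'' ''l'') (RElem ''u'' ''q'')) (RVar ''s'')))) s2 29 (?K i0 (Suc k))"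
      proof (rule runs_RStore)
        let ?s3 = "rstore ''M'' (nval s2 (Index ''l'' ''q''))
          (rval s2 (RSub (REntry ''M'' ''l'' ''q'') (RDiv (RMul (RElem ''u'' ''l'') (RElem ''u'' ''q'')) (RVar ''s'')))) s2"
        have "rcell ?s3 ''M'' = (rcell s2 ''M'')(i0 * n + k := new i0 k)"
          using cells q old by (simp add: new_def)
        then have "entry n ?s3 ''M'' i l = (if i = i0 \<and> l = k then new i0 k else entry n s2 ''M'' i l)"
          if "l < n" for i l
          using entry_upd[OF k that] by blast
        then show "?K i0 (Suc k) ?s3" using K by (auto simp: less_Suc_eq)
      qed simp
    qed auto
    then show "runs (For ''q'' ''n'' (RStore ''M'' (Index ''l'' ''q'')
         (RSub (REntry ''M'' ''l'' ''q'') (RDiv (RMul (RElem ''u'' ''l'') (RElem ''u'' ''q'')) (RVar ''s''))))) s1 (n * 41 + 9) (?I (Suc i0))"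
      by (rule runs_conseq) (auto simp: less_Suc_eq)
  qed (use n T in \<open>auto simp: ac_simps\<close>)
  then show ?thesis by (rule runs_conseq) (auto simp: new_def)
qed

lemma runs_AddRow:
  assumes n: "ncell s ''n'' 0 = n" and i: "ncell s ''i'' 0 = i" and "n \<ge> 1" and "\<epsilon> > 0"
    and inv: "inverse_on n {..<n} (gram i (entry n s ''A'') \<epsilon>) (entry n s ''M'')"
  shows "runs AddRow s (300 * (n * n)) (\<lambda>s'. inverse_on n {..<n} (gram (Suc i) (entry n s ''A'') \<epsilon>) (entry n s' ''M''))"
proof -
  let ?M = "entry n s ''M''" and ?a = "entry n s ''A''"
  define u where "u l = (\<Sum>q<n. ?M l q * ?a i q)" for l
  have nn: "n \<le> n * n" "1 \<le> n * n" using \<open>n \<ge> 1\<close> by auto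
  \<comment> \<open>The times of the four stages; \<open>n \<ge> 1\<close> lets the quadratic term
    absorb the lower ones.\<close>
  have "n * (n * 38 + 26) + 9 + (n * 33 + 13 + (7 + (n * (n * 41 + 21) + 9))) = 79 * (n * n) + 80 * n + 38"
    by (simp add: algebra_simps)
  then have cost: "n * (n * 38 + 26) + 9 + (n * 33 + 13 + (7 + (n * (n * 41 + 21) + 9))) \<le> 300 * (n * n)"
    using nn by linarith
  let ?I = "\<lambda>k s'. \<forall>l<k. rcell s' ''u'' l = u l"
  let ?S = "SumInto ''u'' (NVar ''l'') ''q'' ''n'' (RMul (REntry ''M'' ''l'' ''q'') (REntry ''A'' ''i'' ''q''))"
  show ?thesis
    unfolding AddRow_def
  proof (rule runs_Then)
    show "runs (For ''l'' ''n'' ?S) s (n * (n * 38 + 26) + 9) (?I n)"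
    proof (rule runs_For[where I = ?I and I' = "\<lambda>k. ?I (Suc k)" and N = n and T = "n * 38 + 14"])
      show "?I (Suc k) s''" if "?I (Suc k) s'" "same_except {''l''} {} s' s''" for k s' s''
        using that by (simp add: same_except_def)
      fix k s1
      assume k: "k < n" "?I k s1" "ncell s1 ''l'' 0 = k"
        and s1: "same_except (insert ''l'' (nwrites ?S)) (rwrites ?S) s s1"
      have "runs ?S s1 (n * 38 + 14) (\<lambda>s'. rcell s' ''u'' = (rcell s1 ''u'')(k := \<Sum>q<n. ?M k q * ?a i q))"
        by (rule runs_SumInto) (use k s1 n i in \<open>auto simp: same_except_def entry_def\<close>)
      then show "runs ?S s1 (n * 38 + 14) (?I (Suc k))"
        by (rule runs_conseq) (use k in \<open>auto simp: u_def less_Suc_eq\<close>)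
    qed (use n in auto)
  next
    fix s1 assume u1: "?I n s1" and s1: "same_except (nwrites (For ''l'' ''n'' ?S)) (rwrites (For ''l'' ''n'' ?S)) s s1"
    define \<sigma> where "\<sigma> = (\<Sum>l<n. ?a i l * u l)"
    show "runs (Then (SumInto ''s'' (NConst 0) ''l'' ''n'' (RMul (REntry ''A'' ''i'' ''l'') (RElem ''u'' ''l'')))
      (Then (RStore ''s'' (NConst 0) (RAdd (RNat (NConst 1)) (RVar ''s''))) RankOne)) s1
      (n * 33 + 13 + (7 + (n * (n * 41 + 21) + 9)))
      (\<lambda>s'. inverse_on n {..<n} (gram (Suc i) ?a \<epsilon>) (entry n s' ''M''))"
    proof (rule runs_Then)
      show "runs (SumInto ''s'' (NConst 0) ''l'' ''n'' (RMul (REntry ''A'' ''i'' ''l'') (RElem ''u'' ''l''))) s1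
        (n * 33 + 13) (\<lambda>s'. rcell s' ''s'' = (rcell s1 ''s'')(0 := \<Sum>l<n. ?a i l * u l))"
        by (rule runs_SumInto) (use s1 u1 n i in \<open>auto simp: same_except_def entry_def\<close>)
      fix s2 assume "rcell s2 ''s'' = (rcell s1 ''s'')(0 := \<Sum>l<n. ?a i l * u l)"
        and "same_except (nwrites (SumInto ''s'' (NConst 0) ''l'' ''n'' (RMul (REntry ''A'' ''i'' ''l'') (RElem ''u'' ''l''))))
          (rwrites (SumInto ''s'' (NConst 0) ''l'' ''n'' (RMul (REntry ''A'' ''i'' ''l'') (RElem ''u'' ''l'')))) s1 s2"
      then have s2: "rcell s2 ''s'' 0 = \<sigma>" "rcell s2 ''u'' = rcell s1 ''u''" "rcell s2 ''M'' = rcell s ''M''"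
        "ncell s2 ''n'' 0 = n"
        using s1 n by (simp_all add: same_except_def \<sigma>_def)
      show "runs (Then (RStore ''s'' (NConst 0) (RAdd (RNat (NConst 1)) (RVar ''s''))) RankOne) s2
        (7 + (n * (n * 41 + 21) + 9)) (\<lambda>s'. inverse_on n {..<n} (gram (Suc i) ?a \<epsilon>) (entry n s' ''M''))"
      proof (rule runs_Then)
        show "runs (RStore ''s'' (NConst 0) (RAdd (RNat (NConst 1)) (RVar ''s''))) s2 7 (\<lambda>s'. s' = rstore ''s'' 0 (1 + \<sigma>) s2)"
          by (rule runs_RStore) (use s2 in auto)
        fix s3 assume s3: "s3 = rstore ''s'' 0 (1 + \<sigma>) s2"
        have "runs RankOne s3 (n * (n * 41 + 21) + 9) (\<lambda>s'. \<forall>i<n. \<forall>l<n. entry n s' ''M'' i l =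
            entry n s3 ''M'' i l - rcell s3 ''u'' i * rcell s3 ''u'' l / rcell s3 ''s'' 0)"
          by (rule runs_RankOne) (use s2 s3 in auto)
        then show "runs RankOne s3 (n * (n * 41 + 21) + 9) (\<lambda>s'. inverse_on n {..<n} (gram (Suc i) ?a \<epsilon>) (entry n s' ''M''))"
        proof (rule runs_conseq)
          fix s' assume *: "\<forall>i<n. \<forall>l<n. entry n s' ''M'' i l =
            entry n s3 ''M'' i l - rcell s3 ''u'' i * rcell s3 ''u'' l / rcell s3 ''s'' 0"
          show "inverse_on n {..<n} (gram (Suc i) ?a \<epsilon>) (entry n s' ''M'')"
            by (rule inverse_on_add_row[OF inv \<open>\<epsilon> > 0\<close>, where u = u and s = "1 + \<sigma>"])
              (use * s2 s3 u1 in \<open>auto simp: u_def \<sigma>_def entry_def\<close>)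
        qed simp
      qed simp
    qed simp
  qed (rule cost)
qed

text \<open>Only the diagonal is written; the zeros elsewhere are those of the initial memory.
  Afterwards \<open>M\<close> inverts the Gram matrix of no rows.\<close>

lemma runs_Setup:
  assumes m: "ncell s ''m'' 0 = m" and n: "ncell s ''n'' 0 = n" and "n \<ge> 1"
    and M: "rcell s ''M'' = (\<lambda>_. 0)"
    and tr: "tr = (\<Sum>k<m * n. (rcell s ''A'' k)\<^sup>2)"
    and \<epsilon>: "\<epsilon> = (if tr > 0 then tr / real (n * n) else 1)"
  shows "runs Setup s (100 * ((m + n) * n)) (\<lambda>s'. inverse_on n {..<n} (gram 0 a \<epsilon>) (entry n s' ''M''))"
proof -
  have \<epsilon>0: "\<epsilon> > 0" using \<epsilon> \<open>n \<ge> 1\<close> by auto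
  have nn: "n \<le> n * n" "1 \<le> n * n" using \<open>n \<ge> 1\<close> by auto
  have "(m + n) * n = m * n + n * n" by (simp add: algebra_simps)
  then have cost: "7 + (m * n * 24 + 13 + (17 + (n * 23 + 9))) \<le> 100 * ((m + n) * n)"
    using nn by linarith
  let ?sum = "SumInto ''t'' (NConst 0) ''l'' ''k'' (RMul (RElem ''A'' ''l'') (RElem ''A'' ''l''))"
  let ?cond = "Cond (RLess (RNat (NConst 0)) (RVar ''t''))
      (RStore ''t'' (NConst 0) (RDiv (RNat (NMul (NVar ''n'') (NVar ''n''))) (RVar ''t'')))
      (RStore ''t'' (NConst 0) (RNat (NConst 1)))"
  let ?store = "RStore ''M'' (Index ''l'' ''l'') (RVar ''t'')"
  let ?post = "\<lambda>s'. inverse_on n {..<n} (gram 0 a \<epsilon>) (entry n s' ''M'')"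
  let ?I = "\<lambda>k s'. \<forall>i<n. \<forall>l<n. entry n s' ''M'' i l = (if i = l \<and> i < k then 1 / \<epsilon> else 0)"
  show ?thesis
    unfolding Setup_def
  proof (rule runs_Then[OF _ _ cost])
    show "runs (NStore ''k'' (NConst 0) (NMul (NVar ''m'') (NVar ''n''))) s 7 (\<lambda>s'. ncell s' ''k'' 0 = m * n)"
      by (rule runs_NStore) (use m n in auto)
    fix s1 assume k: "ncell s1 ''k'' 0 = m * n"
      and "same_except (nwrites (NStore ''k'' (NConst 0) (NMul (NVar ''m'') (NVar ''n''))))
        (rwrites (NStore ''k'' (NConst 0) (NMul (NVar ''m'') (NVar ''n'')))) s s1"
    then have s1: "same_except {''k''} {} s s1" by simp
    show "runs (Then ?sum (Then ?cond (For ''l'' ''n'' ?store))) s1 (m * n * 24 + 13 + (17 + (n * 23 + 9))) ?post"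
    proof (rule runs_Then[OF _ _ order_refl])
      show "runs ?sum s1 (m * n * 24 + 13) (\<lambda>s'. rcell s' ''t'' = (rcell s1 ''t'')(0 := \<Sum>k<m * n. (rcell s ''A'' k)\<^sup>2))"
        by (rule runs_SumInto) (use k s1 in \<open>auto simp: same_except_def power2_eq_square\<close>)
      fix s2 assume "rcell s2 ''t'' = (rcell s1 ''t'')(0 := \<Sum>k<m * n. (rcell s ''A'' k)\<^sup>2)"
        and "same_except (nwrites ?sum) (rwrites ?sum) s1 s2"
      then have s2: "rcell s2 ''t'' 0 = tr" "ncell s2 ''n'' 0 = n" "rcell s2 ''M'' = (\<lambda>_. 0)"
        using s1 n M by (simp_all add: same_except_def tr)
      show "runs (Then ?cond (For ''l'' ''n'' ?store)) s2 (17 + (n * 23 + 9)) ?post"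
      proof (rule runs_Then[OF _ _ order_refl])
        show "runs ?cond s2 17 (\<lambda>s'. rcell s' ''t'' 0 = 1 / \<epsilon>)"
          by (rule runs_Cond[where T = 11]; (rule runs_RStore)?) (use s2 \<epsilon> in auto)
        fix s3 assume "rcell s3 ''t'' 0 = 1 / \<epsilon>" and "same_except (nwrites ?cond) (rwrites ?cond) s2 s3"
        then have s3: "rcell s3 ''t'' 0 = 1 / \<epsilon>" "ncell s3 ''n'' 0 = n" "rcell s3 ''M'' = (\<lambda>_. 0)"
          using s2 by (simp_all add: same_except_def)
        have "runs (For ''l'' ''n'' ?store) s3 (n * 23 + 9) (?I n)"
        proof (rule runs_For[where I = ?I and I' = "\<lambda>k. ?I (Suc k)" and N = n and T = 11])
          show "?I 0 s'" if "same_except {''l''} {} s3 s'" for s'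
            using that s3 by (simp add: same_except_def entry_def)
          show "?I (Suc k) s''" if "?I (Suc k) s'" "same_except {''l''} {} s' s''" for k s' s''
            using that by (simp add: same_except_def entry_def)
          fix k s4
          assume k: "k < n" "?I k s4" "ncell s4 ''l'' 0 = k"
            and s4: "same_except (insert ''l'' (nwrites ?store)) (rwrites ?store) s3 s4"
          show "runs ?store s4 11 (?I (Suc k))"
          proof (rule runs_RStore)
            let ?s5 = "rstore ''M'' (nval s4 (Index ''l'' ''l'')) (rval s4 (RVar ''t'')) s4"
            have "rcell ?s5 ''M'' = (rcell s4 ''M'')(k * n + k := 1 / \<epsilon>)"
              using s4 s3 k by (simp add: same_except_def)
            then have "entry n ?s5 ''M'' i l = (if i = k \<and> l = k then 1 / \<epsilon> else entry n s4 ''M'' i l)"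
              if "l < n" for i l
              using entry_upd[OF k(1) that] by blast
            then show "?I (Suc k) ?s5" using k by (auto simp: less_Suc_eq)
          qed simp
        qed (use s3 in auto)
        then show "runs (For ''l'' ''n'' ?store) s3 (n * 23 + 9) ?post"
          by (rule runs_conseq) (auto intro!: inverse_on_init \<epsilon>0)
      qed
    qed
  qed
qed

lemma runs_Select:
  assumes n: "ncell s ''n'' 0 = n" and "n \<ge> 1"
  shows "runs Select s (100 * n) (\<lambda>s'. ncell s' ''p'' 0 < n \<and>
    (\<forall>l<n. entry n s ''M'' l l \<le> entry n s ''M'' (ncell s' ''p'' 0) (ncell s' ''p'' 0)))"
proof -
  let ?c = "Cond (RLess (REntry ''M'' ''p'' ''p'') (REntry ''M'' ''l'' ''l''))
       (NStore ''p'' (NConst 0) (NVar ''l'')) Skip"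
  let ?I = "\<lambda>k s'. ncell s' ''p'' 0 < n \<and>
    (\<forall>l<k. entry n s ''M'' l l \<le> entry n s ''M'' (ncell s' ''p'' 0) (ncell s' ''p'' 0))"
  show ?thesis
    unfolding Select_def
  proof (rule runs_Then)
    show "runs (NStore ''p'' (NConst 0) (NConst 0)) s 3 (\<lambda>s'. s' = nstore ''p'' 0 0 s)"
      by (rule runs_NStore) auto
    fix s1 assume s1: "s1 = nstore ''p'' 0 0 s"
    show "runs (For ''l'' ''n'' ?c) s1 (n * 37 + 9) (?I n)"
    proof (rule runs_For[where I = ?I and I' = "\<lambda>k. ?I (Suc k)" and N = n and T = 25])
      show "?I 0 s'" if "same_except {''l''} {} s1 s'" for s'
        using that s1 \<open>n \<ge> 1\<close> by (simp add: same_except_def)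
      show "?I (Suc k) s''" if "?I (Suc k) s'" "same_except {''l''} {} s' s''" for k s' s''
        using that by (simp add: same_except_def)
      fix k s2
      assume k: "k < n" "?I k s2" "ncell s2 ''l'' 0 = k"
        and s2: "same_except (insert ''l'' (nwrites ?c)) (rwrites ?c) s1 s2"
      have cells: "ncell s2 ''n'' 0 = n" "rcell s2 ''M'' = rcell s ''M''"
        using s2 s1 n by (simp_all add: same_except_def)
      have b: "bval s2 (RLess (REntry ''M'' ''p'' ''p'') (REntry ''M'' ''l'' ''l'')) \<longleftrightarrow>
          entry n s ''M'' (ncell s2 ''p'' 0) (ncell s2 ''p'' 0) < entry n s ''M'' k k"
        using cells k by (simp add: entry_def)
      show "runs ?c s2 25 (?I (Suc k))"
      proof (rule runs_Cond[where T = 4])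
        assume "bval s2 (RLess (REntry ''M'' ''p'' ''p'') (REntry ''M'' ''l'' ''l''))"
        then have "\<forall>l<Suc k. entry n s ''M'' l l \<le> entry n s ''M'' k k"
          unfolding b using k by (force simp: less_Suc_eq)
        then show "runs (NStore ''p'' (NConst 0) (NVar ''l'')) s2 4 (?I (Suc k))"
          by (intro runs_NStore) (use k in auto)
      next
        assume "\<not> bval s2 (RLess (REntry ''M'' ''p'' ''p'') (REntry ''M'' ''l'' ''l''))"
        then show "runs Skip s2 4 (?I (Suc k))"
          unfolding b by (intro runs_Skip) (use k in \<open>auto simp: less_Suc_eq\<close>)
      qed simp
    qed (use s1 n in auto)
  qed (use \<open>n \<ge> 1\<close> in auto)
qed

lemma runs_Correlate:
  assumes m: "ncell s ''m'' 0 = m" and n: "ncell s ''n'' 0 = n" and p: "ncell s ''p'' 0 = p"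
    and "m \<ge> 1" "n \<ge> 1"
  shows "runs Correlate s (200 * (m * n)) (\<lambda>s'. rcell s' ''c'' 0 =
    (\<Sum>r<m. (\<Sum>l<n. entry n s ''A'' r l * rcell s ''x'' l) * (\<Sum>l<n. entry n s ''A'' r l * entry n s ''M'' l p)))"
proof -
  let ?y = "SumInto ''y'' (NConst 0) ''l'' ''n'' (RMul (REntry ''A'' ''i'' ''l'') (RElem ''x'' ''l''))"
  let ?w = "SumInto ''w'' (NConst 0) ''l'' ''n'' (RMul (REntry ''A'' ''i'' ''l'') (REntry ''M'' ''l'' ''p''))"
  let ?c = "RStore ''c'' (NConst 0) (RAdd (RVar ''c'') (RMul (RVar ''y'') (RVar ''w'')))"
  define Y where "Y r = (\<Sum>l<n. entry n s ''A'' r l * rcell s ''x'' l)" for r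
  define W where "W r = (\<Sum>l<n. entry n s ''A'' r l * entry n s ''M'' l p)" for r
  have nn: "n \<le> m * n" "m \<le> m * n" "1 \<le> m * n" using \<open>n \<ge> 1\<close> \<open>m \<ge> 1\<close> by auto
  have "4 + (m * (n * 66 + 48) + 9) = 66 * (m * n) + 48 * m + 13" by (simp add: algebra_simps)
  then have cost: "4 + (m * (n * 66 + 48) + 9) \<le> 200 * (m * n)" using nn by linarith
  let ?I = "\<lambda>k s'. rcell s' ''c'' 0 = (\<Sum>r<k. Y r * W r)"
  have "runs Correlate s (200 * (m * n)) (?I m)"
    unfolding Correlate_def
  proof (rule runs_Then[OF _ _ cost])
    show "runs (RStore ''c'' (NConst 0) (RNat (NConst 0))) s 4 (\<lambda>s'. s' = rstore ''c'' 0 0 s)"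
      by (rule runs_RStore) auto
    fix s1 assume s1: "s1 = rstore ''c'' 0 0 s"
    show "runs (For ''i'' ''m'' (Then ?y (Then ?w ?c))) s1 (m * (n * 66 + 48) + 9) (?I m)"
    proof (rule runs_For[where I = ?I and I' = "\<lambda>k. ?I (Suc k)" and N = m and T = "n * 66 + 36"])
      show "?I 0 s'" if "same_except {''i''} {} s1 s'" for s'
        using that s1 by (simp add: same_except_def)
      show "?I (Suc k) s''" if "?I (Suc k) s'" "same_except {''i''} {} s' s''" for k s' s''
        using that by (simp add: same_except_def)
      fix k s2
      assume k: "k < m" "?I k s2" "ncell s2 ''i'' 0 = k"
        and s2: "same_except (insert ''i'' (nwrites (Then ?y (Then ?w ?c)))) (rwrites (Then ?y (Then ?w ?c))) s1 s2"
      show "runs (Then ?y (Then ?w ?c)) s2 (n * 66 + 36) (?I (Suc k))"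
      proof (rule runs_Then)
        show "runs ?y s2 (n * 30 + 13) (\<lambda>s'. rcell s' ''y'' = (rcell s2 ''y'')(0 := \<Sum>l<n. entry n s ''A'' k l * rcell s ''x'' l))"
          by (rule runs_SumInto) (use k s1 s2 n in \<open>auto simp: same_except_def entry_def\<close>)
        fix s3 assume y3: "rcell s3 ''y'' = (rcell s2 ''y'')(0 := \<Sum>l<n. entry n s ''A'' k l * rcell s ''x'' l)"
          and s3: "same_except (nwrites ?y) (rwrites ?y) s2 s3"
        show "runs (Then ?w ?c) s3 (n * 36 + 23) (?I (Suc k))"
        proof (rule runs_Then)
          show "runs ?w s3 (n * 36 + 13) (\<lambda>s'. rcell s' ''w'' = (rcell s3 ''w'')(0 := \<Sum>l<n. entry n s ''A'' k l * entry n s ''M'' l p))"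
            by (rule runs_SumInto) (use k s1 s2 s3 n p in \<open>auto simp: same_except_def entry_def\<close>)
          fix s4 assume w4: "rcell s4 ''w'' = (rcell s3 ''w'')(0 := \<Sum>l<n. entry n s ''A'' k l * entry n s ''M'' l p)"
            and s4: "same_except (nwrites ?w) (rwrites ?w) s3 s4"
          have "rcell s4 ''c'' 0 = (\<Sum>r<k. Y r * W r)" "rcell s4 ''y'' 0 = Y k" "rcell s4 ''w'' 0 = W k"
            using k s3 s4 y3 w4 by (simp_all add: same_except_def Y_def W_def)
          then show "runs ?c s4 10 (?I (Suc k))"
            by (intro runs_RStore) auto
        qed simp
      qed simp
    qed (use s1 m in \<open>auto simp: ac_simps\<close>)
  qed
  then show ?thesis unfolding Y_def W_def .
qed

text \<open>A running minimum over the moving coordinates, started from an upper estimate for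
  coordinate \<open>p\<close> that need not itself be an admissible step.\<close>

lemma runs_LineSearch:
  assumes n: "ncell s ''n'' 0 = n" and "n \<ge> 1" and p: "p < n" "ncell s ''p'' 0 = p"
    and up: "u p \<noteq> 0" "\<bar>u p\<bar> = entry n s ''M'' p p"
    and u: "\<And>l. l < n \<Longrightarrow> rcell s ''u'' l = u l" and x: "x = rcell s ''x''" "\<And>l. l < n \<Longrightarrow> \<bar>x l\<bar> \<le> 1"
  shows "runs LineSearch s (200 * n) (\<lambda>s'. ncell s' ''f'' 0 < n \<and> u (ncell s' ''f'' 0) \<noteq> 0 \<and>
    rcell s' ''a'' 0 = max_step x u (ncell s' ''f'' 0) \<and>
    (\<forall>l<n. u l \<noteq> 0 \<longrightarrow> rcell s' ''a'' 0 \<le> max_step x u l))"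
proof -
  let ?b = "Cond (RLess (RNat (NConst 0)) (RElem ''u'' ''l''))
              (RStore ''b'' (NConst 0) (RDiv (RSub (RNat (NConst 1)) (RElem ''x'' ''l'')) (RElem ''u'' ''l'')))
              (Cond (RLess (RElem ''u'' ''l'') (RNat (NConst 0)))
                (RStore ''b'' (NConst 0)
                  (RDiv (RSub (RSub (RNat (NConst 0)) (RNat (NConst 1))) (RElem ''x'' ''l'')) (RElem ''u'' ''l'')))
                (RStore ''b'' (NConst 0) (RVar ''a'')))"
  let ?c = "Cond (RLess (RVar ''b'') (RVar ''a''))
              (Then (RStore ''a'' (NConst 0) (RVar ''b'')) (NStore ''f'' (NConst 0) (NVar ''l'')))
              Skip"
  let ?body = "Then ?b ?c"
  \<comment> \<open>The second disjunct describes the time before the first improvement, when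
    \<open>a\<close> is only the estimate and \<open>f\<close> is \<open>p\<close>.\<close>
  let ?I = "\<lambda>k s'. ncell s' ''f'' 0 < n \<and> u (ncell s' ''f'' 0) \<noteq> 0 \<and>
    (rcell s' ''a'' 0 = max_step x u (ncell s' ''f'' 0) \<or> rcell s' ''a'' 0 = 2 / \<bar>u p\<bar> \<and> ncell s' ''f'' 0 = p) \<and>
    (\<forall>l<k. u l \<noteq> 0 \<longrightarrow> rcell s' ''a'' 0 \<le> max_step x u l)"
  have "runs LineSearch s (200 * n) (?I n)"
    unfolding LineSearch_def
  proof (rule runs_Then)
    show "runs (RStore ''a'' (NConst 0) (RDiv (RNat (NConst 2)) (REntry ''M'' ''p'' ''p''))) s 14
        (\<lambda>s'. s' = rstore ''a'' 0 (2 / \<bar>u p\<bar>) s)"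
      by (rule runs_RStore) (use n p up in \<open>auto simp: entry_def\<close>)
    fix s1 assume s1: "s1 = rstore ''a'' 0 (2 / \<bar>u p\<bar>) s"
    show "runs (Then (NStore ''f'' (NConst 0) (NVar ''p'')) (For ''l'' ''n'' ?body)) s1 (4 + (n * 65 + 9)) (?I n)"
    proof (rule runs_Then)
      show "runs (NStore ''f'' (NConst 0) (NVar ''p'')) s1 4 (\<lambda>s'. s' = nstore ''f'' 0 p s1)"
        by (rule runs_NStore) (use p s1 in auto)
      fix s2 assume s2: "s2 = nstore ''f'' 0 p s1"
      show "runs (For ''l'' ''n'' ?body) s2 (n * 65 + 9) (?I n)"
      proof (rule runs_For[where I = ?I and I' = "\<lambda>k. ?I (Suc k)" and N = n and T = 53])
        show "?I 0 s'" if "same_except {''l''} {} s2 s'" for s'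
          using that s1 s2 p up by (simp add: same_except_def)
        show "?I (Suc k) s''" if "?I (Suc k) s'" "same_except {''l''} {} s' s''" for k s' s''
          using that by (simp add: same_except_def)
        fix k s3
        assume k: "k < n" "?I k s3" "ncell s3 ''l'' 0 = k"
          and s3: "same_except (insert ''l'' (nwrites ?body)) (rwrites ?body) s2 s3"
        have cells: "rcell s3 ''u'' k = u k" "rcell s3 ''x'' k = x k"
          using s1 s2 s3 u k x(1) by (simp_all add: same_except_def)
        show "runs ?body s3 53 (?I (Suc k))"
        proof (rule runs_Then)
          \<comment> \<open>For \<open>u k = 0\<close> the cell \<open>b\<close> receives the
            current \<open>a\<close>, so the strict comparison that follows passes over this
            coordinate.\<close>
          show "runs ?b s3 34 (\<lambda>s'. rcell s' ''b'' 0 = (if u k = 0 then rcell s3 ''a'' 0 else max_step x u k))"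
          proof (rule runs_Cond[where T = 27])
            assume "bval s3 (RLess (RNat (NConst 0)) (RElem ''u'' ''l''))"
            then show "runs (RStore ''b'' (NConst 0) (RDiv (RSub (RNat (NConst 1)) (RElem ''x'' ''l'')) (RElem ''u'' ''l''))) s3 27
              (\<lambda>s'. rcell s' ''b'' 0 = (if u k = 0 then rcell s3 ''a'' 0 else max_step x u k))"
              by (intro runs_RStore) (use cells k in \<open>auto simp: max_step_def\<close>)
          next
            assume "\<not> bval s3 (RLess (RNat (NConst 0)) (RElem ''u'' ''l''))"
            then have "u k \<le> 0" using cells k by simp
            show "runs (Cond (RLess (RElem ''u'' ''l'') (RNat (NConst 0)))
                (RStore ''b'' (NConst 0)
                  (RDiv (RSub (RSub (RNat (NConst 0)) (RNat (NConst 1))) (RElem ''x'' ''l'')) (RElem ''u'' ''l'')))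
                (RStore ''b'' (NConst 0) (RVar ''a''))) s3 27
              (\<lambda>s'. rcell s' ''b'' 0 = (if u k = 0 then rcell s3 ''a'' 0 else max_step x u k))"
              by (rule runs_Cond[where T = 20]; (rule runs_RStore)?)
                (use cells k \<open>u k \<le> 0\<close> in \<open>auto simp: max_step_def\<close>)
          qed simp
          fix s4 assume b4: "rcell s4 ''b'' 0 = (if u k = 0 then rcell s3 ''a'' 0 else max_step x u k)"
            and s4: "same_except (nwrites ?b) (rwrites ?b) s3 s4"
          have a4: "rcell s4 ''a'' = rcell s3 ''a''" "ncell s4 = ncell s3"
            using s4 by (auto simp: same_except_def)
          show "runs ?c s4 19 (?I (Suc k))"
          proof (rule runs_Cond[where T = 10])
            assume "bval s4 (RLess (RVar ''b'') (RVar ''a''))"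
            then have lt: "max_step x u k < rcell s3 ''a'' 0" "u k \<noteq> 0" "rcell s4 ''b'' 0 = max_step x u k"
              using b4 a4 by (auto split: if_splits)
            have "\<forall>l<Suc k. u l \<noteq> 0 \<longrightarrow> max_step x u k \<le> max_step x u l"
              using lt(1) k(2) by (force simp: less_Suc_eq)
            then have I: "?I (Suc k) (nstore ''f'' 0 k (rstore ''a'' 0 (max_step x u k) s4))"
              using k lt by simp
            show "runs (Then (RStore ''a'' (NConst 0) (RVar ''b'')) (NStore ''f'' (NConst 0) (NVar ''l''))) s4 10 (?I (Suc k))"
            proof (rule runs_Then)
              show "runs (RStore ''a'' (NConst 0) (RVar ''b'')) s4 4 (\<lambda>s'. s' = rstore ''a'' 0 (max_step x u k) s4)"
                by (rule runs_RStore) (use lt in auto)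
              fix s5 assume "s5 = rstore ''a'' 0 (max_step x u k) s4"
              then show "runs (NStore ''f'' (NConst 0) (NVar ''l'')) s5 4 (?I (Suc k))"
                by (intro runs_NStore) (use I k a4 in auto)
            qed simp
          next
            assume "\<not> bval s4 (RLess (RVar ''b'') (RVar ''a''))"
            then have "u k \<noteq> 0 \<longrightarrow> rcell s3 ''a'' 0 \<le> max_step x u k"
              using b4 a4 by auto
            then show "runs Skip s4 10 (?I (Suc k))"
              by (intro runs_Skip) (use k a4 in \<open>auto simp: less_Suc_eq\<close>)
          qed simp
        qed simp
      qed (use s1 s2 n in auto)
    qed simp
  qed (use \<open>n \<ge> 1\<close> in auto)
  then show ?thesis
  proof (rule runs_conseq)
    fix s' assume I: "?I n s'"
    \<comment> \<open>If \<open>a\<close> still has its starting value, it has been compared with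
      the step of \<open>p\<close> and not been replaced; as that step is at most the starting
      value, the two agree.\<close>
    have "rcell s' ''a'' 0 = max_step x u (ncell s' ''f'' 0)"
    proof (rule ccontr)
      assume neq: "rcell s' ''a'' 0 \<noteq> max_step x u (ncell s' ''f'' 0)"
      then have "rcell s' ''a'' 0 = 2 / \<bar>u p\<bar>" "ncell s' ''f'' 0 = p" using I by auto
      moreover have "rcell s' ''a'' 0 \<le> max_step x u p" using I p up by blast
      moreover have "max_step x u p \<le> 2 / \<bar>u p\<bar>" using max_step_le x(2) p up by blast
      ultimately show False using neq by simp
    qed
    then show "ncell s' ''f'' 0 < n \<and> u (ncell s' ''f'' 0) \<noteq> 0 \<and>
      rcell s' ''a'' 0 = max_step x u (ncell s' ''f'' 0) \<and>
      (\<forall>l<n. u l \<noteq> 0 \<longrightarrow> rcell s' ''a'' 0 \<le> max_step x u l)"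
      using I by blast
  qed simp
qed

text \<open>\<open>J\<close> exists only in the proof; the memory represents it through
  \<open>M\<close> alone.\<close>

lemma runs_WalkStep:
  assumes m: "ncell s ''m'' 0 = m" and n: "ncell s ''n'' 0 = n" and "m \<ge> 1" "n \<ge> 1" and "\<epsilon> > 0"
    and H: "herdisc_bound m n (entry n s ''A'') H" and B: "B = disc_const * (H + \<epsilon> * real n)"
    and W: "walk_inv m n (entry n s ''A'') \<epsilon> B J (entry n s ''M'') (rcell s ''x'')" and "J \<noteq> {}"
  shows "runs WalkStep s (1000 * ((m + n) * n)) (\<lambda>s'. \<exists>f\<in>J.
    walk_inv m n (entry n s ''A'') \<epsilon> B (J - {f}) (entry n s' ''M'') (rcell s' ''x''))"
proof -
  let ?a = "entry n s ''A''" and ?M = "entry n s ''M''" and ?x = "rcell s ''x''"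
  let ?Q = "\<lambda>s'. \<exists>f\<in>J. walk_inv m n ?a \<epsilon> B (J - {f}) (entry n s' ''M'') (rcell s' ''x'')"
  let ?c3 = "SumInto ''e'' (NConst 0) ''l'' ''n'' (RMul (RElem ''x'' ''l'') (REntry ''M'' ''l'' ''p''))"
  let ?c4 = "Cond (RLess (RVar ''e'') (RMul (REntry ''M'' ''p'' ''p'') (RVar ''c'')))
            (RStore ''g'' (NConst 0) (RSub (RNat (NConst 0)) (RNat (NConst 1))))
            (RStore ''g'' (NConst 0) (RNat (NConst 1)))"
  let ?c5 = "Fill ''u'' ''l'' ''n'' (RMul (RVar ''g'') (REntry ''M'' ''l'' ''p''))"
  let ?c7 = "Fill ''x'' ''l'' ''n'' (RAdd (RElem ''x'' ''l'') (RMul (RVar ''a'') (RElem ''u'' ''l'')))"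
  let ?c8 = "Fill ''u'' ''l'' ''n'' (REntry ''M'' ''l'' ''f'')"
  let ?c9 = "RStore ''s'' (NConst 0) (REntry ''M'' ''f'' ''f'')"
  \<comment> \<open>Each \<open>?t\<close> bounds the time from the stage with its number to the end
    of the step.\<close>
  let ?t9 = "11 + (n * (n * 41 + 21) + 9)"
  let ?t8 = "n * 24 + 9 + ?t9"
  let ?t7 = "n * 25 + 9 + ?t8"
  let ?t6 = "200 * n + ?t7"
  let ?t5 = "n * 27 + 9 + ?t6"
  let ?t4 = "23 + ?t5"
  let ?t3 = "n * 30 + 13 + ?t4"
  let ?t2 = "200 * (m * n) + ?t3"
  have cost: "100 * n + ?t2 \<le> 1000 * ((m + n) * n)"
  proof -
    define P where "P = m * n"
    define R where "R = n * n"
    have "n \<le> R" "1 \<le> R" unfolding R_def using \<open>n \<ge> 1\<close> by auto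
    moreover have "100 * n + ?t2 = 200 * P + 41 * R + 427 * n + 83"
      unfolding P_def R_def by (simp add: algebra_simps)
    moreover have "(m + n) * n = P + R" unfolding P_def R_def by (simp add: algebra_simps)
    ultimately show ?thesis by simp
  qed
  have inv: "inverse_on n J (gram m ?a \<epsilon>) ?M" and x1: "\<And>l. l < n \<Longrightarrow> \<bar>?x l\<bar> \<le> 1"
    using W unfolding walk_inv_def by auto
  show ?thesis
    unfolding WalkStep_def
  proof (rule runs_Then[OF runs_Select[OF n \<open>n \<ge> 1\<close>] _ cost])
    fix s1 :: mem
    define p where "p = ncell s1 ''p'' 0"
    assume sel: "ncell s1 ''p'' 0 < n \<and> (\<forall>l<n. ?M l l \<le> ?M (ncell s1 ''p'' 0) (ncell s1 ''p'' 0))"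
      and same1: "same_except (nwrites Select) (rwrites Select) s s1"
    have p: "p < n" and max: "\<And>l. l < n \<Longrightarrow> ?M l l \<le> ?M p p" using sel unfolding p_def by auto
    define c where "c = (\<Sum>r<m. (\<Sum>l<n. ?a r l * ?x l) * (\<Sum>l<n. ?a r l * ?M l p))"
    define e where "e = (\<Sum>l<n. ?x l * ?M l p)"
    have Mp: "?M p p > 0"
    proof -
      obtain j where "j \<in> J" using \<open>J \<noteq> {}\<close> by auto
      then have "?M j j > 0" "j < n"
        using inverse_on_diag_pos[OF inv _ \<open>\<epsilon> > 0\<close>] inv unfolding inverse_on_def by auto
      then show ?thesis using max by fastforce
    qed
    have s1: "ncell s1 ''m'' 0 = m" "ncell s1 ''n'' 0 = n" "ncell s1 ''p'' 0 = p" "rcell s1 = rcell s"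
      using same1 m n by (auto simp: same_except_def p_def)
    show "runs (Then Correlate (Then ?c3 (Then ?c4 (Then ?c5 (Then LineSearch (Then ?c7 (Then ?c8 (Then ?c9 RankOne)))))))) s1 ?t2 ?Q"
    proof (rule runs_Then[OF runs_Correlate[OF s1(1-3) \<open>m \<ge> 1\<close> \<open>n \<ge> 1\<close>] _ order_refl])
      fix s2
      assume "rcell s2 ''c'' 0 = (\<Sum>r<m. (\<Sum>l<n. entry n s1 ''A'' r l * rcell s1 ''x'' l) *
          (\<Sum>l<n. entry n s1 ''A'' r l * entry n s1 ''M'' l p))"
        and "same_except (nwrites Correlate) (rwrites Correlate) s1 s2"
      then have s2: "rcell s2 ''c'' 0 = c" "ncell s2 ''n'' 0 = n" "ncell s2 ''p'' 0 = p"
          "rcell s2 ''x'' = ?x" "rcell s2 ''M'' = rcell s ''M''"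
        using s1 by (simp_all add: same_except_def entry_def c_def)
      show "runs (Then ?c3 (Then ?c4 (Then ?c5 (Then LineSearch (Then ?c7 (Then ?c8 (Then ?c9 RankOne))))))) s2 ?t3 ?Q"
      proof (rule runs_Then[OF _ _ order_refl])
        show "runs ?c3 s2 (n * 30 + 13) (\<lambda>s'. rcell s' ''e'' = (rcell s2 ''e'')(0 := \<Sum>l<n. ?x l * ?M l p))"
          by (rule runs_SumInto) (use s2 in \<open>auto simp: same_except_def entry_def\<close>)
        fix s3 assume "rcell s3 ''e'' = (rcell s2 ''e'')(0 := \<Sum>l<n. ?x l * ?M l p)"
          and "same_except (nwrites ?c3) (rwrites ?c3) s2 s3"
        then have s3: "rcell s3 ''e'' 0 = e" "rcell s3 ''c'' 0 = c" "ncell s3 ''n'' 0 = n" "ncell s3 ''p'' 0 = p"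
          "rcell s3 ''x'' = ?x" "rcell s3 ''M'' = rcell s ''M''"
          using s2 by (simp_all add: same_except_def e_def)
        show "runs (Then ?c4 (Then ?c5 (Then LineSearch (Then ?c7 (Then ?c8 (Then ?c9 RankOne)))))) s3 ?t4 ?Q"
        proof (rule runs_Then[OF _ _ order_refl])
          show "runs ?c4 s3 23 (\<lambda>s'. rcell s' ''g'' 0 = (if e < ?M p p * c then -1 else 1))"
            by (rule runs_Cond[where T = 7]; (rule runs_RStore)?) (use s3 in \<open>auto simp: entry_def\<close>)
          fix s4 :: mem
          define g where "g = rcell s4 ''g'' 0"
          assume g4: "rcell s4 ''g'' 0 = (if e < ?M p p * c then -1 else 1)"
            and same4: "same_except (nwrites ?c4) (rwrites ?c4) s3 s4"
          \<comment> \<open>\<open>g\<close> is opposite in sign to the linear part; when that part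
            is zero, either sign would do and \<open>g\<close> is 1.\<close>
          have sign: "g * (?M p p * c - e) \<le> 0" and g: "\<bar>g\<bar> = 1" using g4 by (auto simp: g_def)
          have s4: "ncell s4 ''n'' 0 = n" "ncell s4 ''p'' 0 = p"
            "rcell s4 ''x'' = ?x" "rcell s4 ''M'' = rcell s ''M''"
            using s3 same4 by (simp_all add: same_except_def)
          define u where "u l = g * ?M l p" for l
          show "runs (Then ?c5 (Then LineSearch (Then ?c7 (Then ?c8 (Then ?c9 RankOne))))) s4 ?t5 ?Q"
          proof (rule runs_Then[OF _ _ order_refl])
            show "runs ?c5 s4 (n * 27 + 9) (\<lambda>s'. \<forall>k<n. rcell s' ''u'' k = u k)"
              by (rule runs_Fill) (use s4 in \<open>auto simp: same_except_def entry_def u_def g_def\<close>)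
            fix s5 assume u5: "\<forall>k<n. rcell s5 ''u'' k = u k" and "same_except (nwrites ?c5) (rwrites ?c5) s4 s5"
            then have s5: "ncell s5 ''n'' 0 = n" "ncell s5 ''p'' 0 = p"
              "?x = rcell s5 ''x''" "rcell s5 ''M'' = rcell s ''M''"
              using s4 by (simp_all add: same_except_def)
            have up: "u p \<noteq> 0" "\<bar>u p\<bar> = entry n s5 ''M'' p p"
              using Mp g s5 by (auto simp: u_def abs_mult entry_def)
            show "runs (Then LineSearch (Then ?c7 (Then ?c8 (Then ?c9 RankOne)))) s5 ?t6 ?Q"
            proof (rule runs_Then[OF runs_LineSearch[where u = u, OF s5(1) \<open>n \<ge> 1\<close> p s5(2) up _ s5(3) x1] _ order_refl])
              show "rcell s5 ''u'' l = u l" if "l < n" for l using u5 that by blast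
              fix s6 :: mem
              define f where "f = ncell s6 ''f'' 0"
              define \<alpha> where "\<alpha> = rcell s6 ''a'' 0"
              assume ls: "ncell s6 ''f'' 0 < n \<and> u (ncell s6 ''f'' 0) \<noteq> 0 \<and>
                  rcell s6 ''a'' 0 = max_step ?x u (ncell s6 ''f'' 0) \<and>
                  (\<forall>l<n. u l \<noteq> 0 \<longrightarrow> rcell s6 ''a'' 0 \<le> max_step ?x u l)"
                and same6: "same_except (nwrites LineSearch) (rwrites LineSearch) s5 s6"
              have f: "f < n" "u f \<noteq> 0" "\<alpha> = max_step ?x u f"
                "\<And>l. l < n \<Longrightarrow> u l \<noteq> 0 \<Longrightarrow> \<alpha> \<le> max_step ?x u l"
                using ls unfolding f_def \<alpha>_def by blast+
              have s6: "ncell s6 ''n'' 0 = n" "ncell s6 ''f'' 0 = f" "rcell s6 ''a'' 0 = \<alpha>"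
                "rcell s6 ''x'' = ?x" "rcell s6 ''M'' = rcell s ''M''" "\<forall>k<n. rcell s6 ''u'' k = u k"
                using s5 u5 same6 by (simp_all add: same_except_def f_def \<alpha>_def)
              show "runs (Then ?c7 (Then ?c8 (Then ?c9 RankOne))) s6 ?t7 ?Q"
              proof (rule runs_Then[OF _ _ order_refl])
                show "runs ?c7 s6 (n * 25 + 9) (\<lambda>s'. \<forall>k<n. rcell s' ''x'' k = ?x k + \<alpha> * u k)"
                  by (rule runs_Fill) (use s6 in \<open>auto simp: same_except_def\<close>)
                fix s7 assume x7: "\<forall>k<n. rcell s7 ''x'' k = ?x k + \<alpha> * u k"
                  and "same_except (nwrites ?c7) (rwrites ?c7) s6 s7"
                then have s7: "ncell s7 ''n'' 0 = n" "ncell s7 ''f'' 0 = f" "rcell s7 ''M'' = rcell s ''M''"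
                  using s6 by (simp_all add: same_except_def)
                show "runs (Then ?c8 (Then ?c9 RankOne)) s7 ?t8 ?Q"
                proof (rule runs_Then[OF _ _ order_refl])
                  show "runs ?c8 s7 (n * 24 + 9) (\<lambda>s'. \<forall>k<n. rcell s' ''u'' k = ?M k f)"
                    by (rule runs_Fill) (use s7 in \<open>auto simp: same_except_def entry_def\<close>)
                  fix s8 assume u8: "\<forall>k<n. rcell s8 ''u'' k = ?M k f"
                    and "same_except (nwrites ?c8) (rwrites ?c8) s7 s8"
                  then have s8: "ncell s8 ''n'' 0 = n" "ncell s8 ''f'' 0 = f" "rcell s8 ''M'' = rcell s ''M''"
                    "rcell s8 ''x'' = rcell s7 ''x''"
                    using s7 by (simp_all add: same_except_def)
                  show "runs (Then ?c9 RankOne) s8 ?t9 ?Q"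
                  proof (rule runs_Then[OF _ _ order_refl])
                    show "runs ?c9 s8 11 (\<lambda>s'. s' = rstore ''s'' 0 (?M f f) s8)"
                      by (rule runs_RStore) (use s8 in \<open>auto simp: entry_def\<close>)
                    fix s9 assume s9: "s9 = rstore ''s'' 0 (?M f f) s8"
                    then have "ncell s9 ''n'' 0 = n" using s8 by simp
                    from runs_RankOne[OF this order_refl]
                    show "runs RankOne s9 (n * (n * 41 + 21) + 9) ?Q"
                    proof (rule runs_conseq)
                      fix s' assume M': "\<forall>i<n. \<forall>l<n. entry n s' ''M'' i l = entry n s9 ''M'' i l -
                          rcell s9 ''u'' i * rcell s9 ''u'' l / rcell s9 ''s'' 0"
                        and "same_except (nwrites RankOne) (rwrites RankOne) s9 s'"
                      then have x': "rcell s' ''x'' = rcell s7 ''x''"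
                        using s9 s8 by (simp add: same_except_def)
                      have x'eq: "rcell s' ''x'' l = ?x l + \<alpha> * u l" if "l < n" for l
                        using x' x7 that by simp
                      have M'eq: "entry n s' ''M'' i l = ?M i l - ?M i f * ?M l f / ?M f f"
                        if "i < n" "l < n" for i l
                        using M' u8 s9 s8 that by (simp add: entry_def)
                      note step = walk_inv_step[OF W \<open>\<epsilon> > 0\<close> \<open>J \<noteq> {}\<close> H B p max
                          sign[unfolded c_def e_def] u_def f x'eq M'eq]
                      show "?Q s'" using step by blast
                    qed simp
                  qed
                qed
              qed
            qed
          qed
        qed
      qed
    qed
  qed
qed

text \<open>The bound holds for any admissible \<open>H\<close>, so hereditary discrepancy itself
  enters only afterwards.\<close>

lemma runs_Program:
  assumes m: "ncell s ''m'' 0 = m" and n: "ncell s ''n'' 0 = n" and "m \<ge> 1" "n \<ge> 1"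
    and zero: "rcell s ''M'' = (\<lambda>_. 0)" "rcell s ''x'' = (\<lambda>_. 0)"
    and H: "herdisc_bound m n (entry n s ''A'') H"
    and tr: "tr = (\<Sum>k<m * n. (rcell s ''A'' k)\<^sup>2)"
    and \<epsilon>: "\<epsilon> = (if tr > 0 then tr / real (n * n) else 1)"
  shows "runs Program s (1500 * ((m + n) * (n * n))) (\<lambda>s'. (\<forall>l<n. rcell s' ''x'' l \<in> {-1, 1}) \<and>
    energy m (entry n s ''A'') {..<n} (rcell s' ''x'') \<le> disc_const * (H + \<epsilon> * real n) * harmonic n)"
proof -
  let ?a = "entry n s ''A''"
  define B where "B = disc_const * (H + \<epsilon> * real n)"
  let ?Q = "\<lambda>s'. (\<forall>l<n. rcell s' ''x'' l \<in> {-1, 1}) \<and> energy m ?a {..<n} (rcell s' ''x'') \<le> B * harmonic n"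
  have \<epsilon>0: "\<epsilon> > 0" using \<epsilon> \<open>n \<ge> 1\<close> by auto
  let ?t1 = "m * (300 * (n * n) + 12) + 9" and ?t2 = "n * (1000 * ((m + n) * n) + 12) + 9"
  let ?X = "(m + n) * (n * n)"
  have cost: "100 * ((m + n) * n) + (?t1 + ?t2) \<le> 1500 * ?X"
  proof -
    define X where "X = ?X"
    define Y where "Y = (m + n) * n"
    define Z where "Z = m * (n * n)"
    have nn: "n \<le> n * n" "1 \<le> n * n" using \<open>n \<ge> 1\<close> by auto
    have "Y \<le> X" unfolding X_def Y_def using nn by (intro mult_left_mono) auto
    moreover have "Z \<le> X" unfolding X_def Z_def by simp
    moreover have "m + n \<le> X" "1 \<le> X" unfolding X_def using nn \<open>n \<ge> 1\<close> by auto
    moreover have "100 * Y + (300 * Z + 12 * k + 18 + 1000 * X) \<le> 1500 * X"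
      if "Y \<le> X" "Z \<le> X" "k \<le> X" "1 \<le> X" for k
      using that by linarith
    ultimately have "100 * Y + (300 * Z + 12 * (m + n) + 18 + 1000 * X) \<le> 1500 * X" by blast
    moreover have "?t1 + ?t2 = 300 * Z + 12 * (m + n) + 18 + 1000 * X"
      unfolding X_def Z_def by (simp add: algebra_simps)
    ultimately show ?thesis unfolding X_def Y_def by (simp only:)
  qed
  let ?I1 = "\<lambda>k s'. inverse_on n {..<n} (gram k ?a \<epsilon>) (entry n s' ''M'')"
  \<comment> \<open>Only the number of free coordinates is fixed by the pass; which ones they are
    depends on the walk.\<close>
  let ?I2 = "\<lambda>k s'. \<exists>J. card J = n - k \<and> walk_inv m n ?a \<epsilon> B J (entry n s' ''M'') (rcell s' ''x'')"
  have "runs Program s (1500 * ?X) ?Q"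
    unfolding Program_def
  proof (rule runs_Then[OF runs_Setup[OF m n \<open>n \<ge> 1\<close> zero(1) tr \<epsilon>, of ?a] _ cost])
    fix s1 assume I1: "?I1 0 s1" and same1: "same_except (nwrites Setup) (rwrites Setup) s s1"
    have s1: "ncell s1 ''m'' 0 = m" "ncell s1 ''n'' 0 = n" "rcell s1 ''A'' = rcell s ''A''" "rcell s1 ''x'' = (\<lambda>_. 0)"
      using same1 m n zero by (simp_all add: same_except_def)
    show "runs (Then (For ''i'' ''m'' AddRow) (For ''h'' ''n'' WalkStep)) s1 (?t1 + ?t2) ?Q"
    proof (rule runs_Then[OF _ _ order_refl])
      show "runs (For ''i'' ''m'' AddRow) s1 ?t1 (?I1 m)"
      proof (rule runs_For[where I = ?I1 and I' = "\<lambda>k. ?I1 (Suc k)" and N = m and T = "300 * (n * n)"])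
        show "?I1 0 s'" if "same_except {''i''} {} s1 s'" for s'
          using that I1 by (simp add: same_except_def entry_def[abs_def])
        show "?I1 (Suc k) s''" if "?I1 (Suc k) s'" "same_except {''i''} {} s' s''" for k s' s''
          using that by (simp add: same_except_def entry_def[abs_def])
        fix k s2
        assume k: "k < m" "?I1 k s2" "ncell s2 ''i'' 0 = k"
          and "same_except (insert ''i'' (nwrites AddRow)) (rwrites AddRow) s1 s2"
        then have s2: "ncell s2 ''n'' 0 = n" "entry n s2 ''A'' = ?a"
          using s1 by (simp_all add: same_except_def entry_def[abs_def])
        show "runs AddRow s2 (300 * (n * n)) (?I1 (Suc k))"
          using runs_AddRow[OF s2(1) k(3) \<open>n \<ge> 1\<close> \<epsilon>0] k(2) unfolding s2(2) by blast
      qed (use s1 in auto)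
      fix s2 assume I2: "?I1 m s2" and same2: "same_except (nwrites (For ''i'' ''m'' AddRow)) (rwrites (For ''i'' ''m'' AddRow)) s1 s2"
      have s2: "ncell s2 ''m'' 0 = m" "ncell s2 ''n'' 0 = n" "rcell s2 ''A'' = rcell s ''A''" "rcell s2 ''x'' = (\<lambda>_. 0)"
        using same2 s1 by (simp_all add: same_except_def)
      have "runs (For ''h'' ''n'' WalkStep) s2 ?t2 (?I2 n)"
      proof (rule runs_For[where I = ?I2 and I' = "\<lambda>k. ?I2 (Suc k)" and N = n and T = "1000 * ((m + n) * n)"])
        show "?I2 0 s'" if "same_except {''h''} {} s2 s'" for s'
        proof -
          have "walk_inv m n ?a \<epsilon> B {..<n} (entry n s' ''M'') (rcell s' ''x'')"
            by (rule walk_inv_init) (use that I2 s2 in \<open>simp_all add: same_except_def entry_def[abs_def]\<close>)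
          then show ?thesis by (intro exI[of _ "{..<n}"]) simp
        qed
        show "?I2 (Suc k) s''" if "?I2 (Suc k) s'" "same_except {''h''} {} s' s''" for k s' s''
          using that by (simp add: same_except_def entry_def[abs_def])
        fix k s3
        assume k: "k < n" "?I2 k s3"
          and "same_except (insert ''h'' (nwrites WalkStep)) (rwrites WalkStep) s2 s3"
        then have s3: "ncell s3 ''m'' 0 = m" "ncell s3 ''n'' 0 = n" "entry n s3 ''A'' = ?a"
          using s2 by (simp_all add: same_except_def entry_def[abs_def])
        obtain J where J: "card J = n - k" "walk_inv m n ?a \<epsilon> B J (entry n s3 ''M'') (rcell s3 ''x'')"
          using k by blast
        then have "J \<noteq> {}" using k by auto
        have "runs WalkStep s3 (1000 * ((m + n) * n)) (\<lambda>s'. \<exists>f\<in>J.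
            walk_inv m n ?a \<epsilon> B (J - {f}) (entry n s' ''M'') (rcell s' ''x''))"
          using runs_WalkStep[OF s3(1,2) \<open>m \<ge> 1\<close> \<open>n \<ge> 1\<close> \<epsilon>0 _ B_def _ \<open>J \<noteq> {}\<close>] H J(2) unfolding s3(3) by blast
        then show "runs WalkStep s3 (1000 * ((m + n) * n)) (?I2 (Suc k))"
        proof (rule runs_conseq)
          fix s' assume "\<exists>f\<in>J. walk_inv m n ?a \<epsilon> B (J - {f}) (entry n s' ''M'') (rcell s' ''x'')"
          then obtain f where f: "f \<in> J" "walk_inv m n ?a \<epsilon> B (J - {f}) (entry n s' ''M'') (rcell s' ''x'')"
            by blast
          then have "card (J - {f}) = n - Suc k" using J(1) by simp
          then show "?I2 (Suc k) s'" using f by blast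
        qed simp
      qed (use s2 in auto)
      then show "runs (For ''h'' ''n'' WalkStep) s2 ?t2 ?Q"
      proof (rule runs_conseq)
        fix s' assume "?I2 n s'"
        then obtain J where J: "card J = 0" "walk_inv m n ?a \<epsilon> B J (entry n s' ''M'') (rcell s' ''x'')"
          by auto
        \<comment> \<open>Cardinality 0 would also fit an infinite set; the invariant provides
          finiteness.\<close>
        then have "J = {}" using inverse_on_finite unfolding walk_inv_def by auto
        then show "?Q s'" using walk_inv_final J(2) by blast
      qed simp
    qed
  qed
  then show ?thesis unfolding B_def .
qed

section \<open>Transfer between the walk and \<open>herdisc2\<close>\<close>

section \<open>Hereditary discrepancy\<close>

lemma disc2_of_energy:
  assumes "A \<in> carrier_mat m n" and "x \<in> carrier_vec n"
    and a: "\<And>r l. r < m \<Longrightarrow> l < n \<Longrightarrow> a r l = A $$ (r, l)" and z: "\<And>l. l < n \<Longrightarrow> z l = x $ l"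
  shows "disc2_of A x = sqrt (energy m a {..<n} z) / sqrt (real m)"
proof -
  have "(A *\<^sub>v x) $ r = (\<Sum>l<n. a r l * z l)" if "r < m" for r
    using assms that by (auto simp: scalar_prod_def atLeast0LessThan intro!: sum.cong)
  then have "L2_set (\<lambda>i. (A *\<^sub>v x) $ i) {..<m} = sqrt (energy m a {..<n} z)"
    unfolding L2_set_def energy_def by simp
  then show ?thesis unfolding disc2_of_def using assms(1) by simp
qed

lemma disc2_of_nonneg: "disc2_of A x \<ge> 0"
  unfolding disc2_of_def by (simp add: L2_set_nonneg)

lemma finite_colorings: "finite (colorings n)"
proof (rule finite_subset)
  show "colorings n \<subseteq> vec n ` PiE {..<n} (\<lambda>_. {-1, 1})"
  proof
    fix x :: "real vec" assume x: "x \<in> colorings n"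
    then have "x = vec n (restrict (($) x) {..<n})" unfolding colorings_def by auto
    moreover have "restrict (($) x) {..<n} \<in> PiE {..<n} (\<lambda>_. {-1, 1})" using x unfolding colorings_def by auto
    ultimately show "x \<in> vec n ` PiE {..<n} (\<lambda>_. {-1, 1})" by blast
  qed
qed (auto intro: finite_PiE)

lemma colorings_nonempty: "colorings n \<noteq> {}"
proof -
  have "vec n (\<lambda>_. 1) \<in> colorings n" unfolding colorings_def by auto
  then show ?thesis by blast
qed

lemma disc2_attained: "\<exists>x\<in>colorings (dim_col B). disc2_of B x = disc2 B"
  unfolding disc2_def using Min_in[of "disc2_of B ` colorings (dim_col B)"]
  by (metis (no_types, lifting) finite_colorings colorings_nonempty finite_imageI image_iff image_is_empty)

lemma disc2_le_herdisc2:
  assumes "J \<subseteq> {..<dim_col A}" and "J \<noteq> {}"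
  shows "disc2 (submatrix A UNIV J) \<le> herdisc2 A"
proof -
  let ?D = "{disc2 (submatrix A UNIV J) | J. J \<subseteq> {..<dim_col A} \<and> J \<noteq> {}}"
  have "?D = (\<lambda>J. disc2 (submatrix A UNIV J)) ` {J \<in> Pow {..<dim_col A}. J \<noteq> {}}" by auto
  then have "finite ?D" by simp
  then show ?thesis unfolding herdisc2_def using assms by (intro Max_ge) blast+
qed

lemma herdisc2_nonneg:
  assumes "dim_col A \<ge> 1"
  shows "herdisc2 A \<ge> 0"
proof -
  have "disc2 (submatrix A UNIV {..<dim_col A}) \<le> herdisc2 A"
    using assms by (intro disc2_le_herdisc2) (auto simp: lessThan_empty_iff)
  then show ?thesis using disc2_attained disc2_of_nonneg by (metis order_trans)
qed

text \<open>An optimal coloring of the submatrix on the columns \<open>S\<close> is moved back to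
  the original indices and extended by zero. The empty set is treated apart because
  \<open>herdisc2\<close> ranges over nonempty ones.\<close>

lemma herdisc_bound_herdisc2:
  assumes A: "A \<in> carrier_mat m n" and "m \<ge> 1" "n \<ge> 1"
    and a: "\<And>r l. r < m \<Longrightarrow> l < n \<Longrightarrow> a r l = A $$ (r, l)"
  shows "herdisc_bound m n a (real m * (herdisc2 A)\<^sup>2)"
  unfolding herdisc_bound_def
proof (intro allI impI)
  fix S assume S: "S \<subseteq> {..<n}"
  show "\<exists>z. (\<forall>l\<in>S. z l \<in> {-1, 1}) \<and> (\<forall>l. l \<notin> S \<longrightarrow> z l = 0) \<and> energy m a {..<n} z \<le> real m * (herdisc2 A)\<^sup>2"
  proof (cases "S = {}")
    case True
    then show ?thesis by (intro exI[of _ "\<lambda>_. 0"]) (simp add: energy_def)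
  next
    case False
    define k where "k = card S"
    define B where "B = submatrix A UNIV S"
    \<comment> \<open>The inverse of \<open>pick S\<close>, which enumerates \<open>S\<close> in
      increasing order.\<close>
    define rank where "rank l = card {a \<in> S. a < l}" for l
    have fin: "finite S" using S finite_subset by blast
    have Sn: "{j. j < n \<and> j \<in> S} = S" using S by auto
    have dimA: "dim_row A = m" "dim_col A = n" using A by auto
    have dim: "B \<in> carrier_mat m k"
      unfolding carrier_mat_def B_def k_def by (simp add: dim_submatrix dimA Sn)
    have B: "B $$ (r, j) = a r (pick S j)" if "r < m" "j < k" for r j
    proof -
      have "pick S j < n" using pick_in_set_le[of j S] that S unfolding k_def by auto
      then show ?thesis
        unfolding B_def using that a submatrix_index[of r A UNIV j S]
        by (simp add: dimA Sn k_def[symmetric] pick_UNIV)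
    qed
    obtain \<chi> where \<chi>: "\<chi> \<in> colorings k" "disc2_of B \<chi> = disc2 B"
      using disc2_attained[of B] dim by auto
    have \<chi>vec: "\<chi> \<in> carrier_vec k" and \<chi>1: "\<And>j. j < k \<Longrightarrow> \<chi> $ j \<in> {-1, 1}"
      using \<chi>(1) unfolding colorings_def by auto
    have rank: "rank l < k" "pick S (rank l) = l" if "l \<in> S" for l
    proof -
      show "rank l < k" unfolding rank_def k_def using that fin by (intro psubset_card_mono) auto
      show "pick S (rank l) = l" unfolding rank_def using that by (rule pick_card_in_set)
    qed
    have pick: "pick S j \<in> S" "rank (pick S j) = j" if "j < k" for j
      using that pick_in_set_le card_pick_le unfolding rank_def k_def by auto
    define z where "z l = (if l \<in> S then \<chi> $ rank l else 0)" for l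
    have "(\<Sum>l<n. a r l * z l) = (\<Sum>j<k. a r (pick S j) * \<chi> $ j)" for r
    proof -
      have "(\<Sum>l<n. a r l * z l) = (\<Sum>l\<in>S. a r l * \<chi> $ rank l)"
        using S by (intro sum.mono_neutral_cong_right) (auto simp: z_def)
      also have "\<dots> = (\<Sum>j<k. a r (pick S j) * \<chi> $ j)"
        by (rule sum.reindex_bij_witness[of _ "pick S" rank]) (auto simp: rank pick)
      finally show ?thesis .
    qed
    then have "energy m a {..<n} z = energy m (\<lambda>r j. a r (pick S j)) {..<k} (($) \<chi>)"
      unfolding energy_def by simp
    moreover have "disc2_of B \<chi> = sqrt (energy m (\<lambda>r j. a r (pick S j)) {..<k} (($) \<chi>)) / sqrt (real m)"
      by (rule disc2_of_energy[OF dim \<chi>vec]) (auto simp: B)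
    moreover have "disc2_of B \<chi> \<le> herdisc2 A"
      using disc2_le_herdisc2[of S A] S False dimA \<chi>(2) unfolding B_def by simp
    ultimately have "sqrt (energy m a {..<n} z) / sqrt (real m) \<le> herdisc2 A" by simp
    then have "sqrt (energy m a {..<n} z) \<le> sqrt (real m) * herdisc2 A"
      using \<open>m \<ge> 1\<close> by (simp add: field_simps)
    then have "(sqrt (energy m a {..<n} z))\<^sup>2 \<le> (sqrt (real m) * herdisc2 A)\<^sup>2"
      by (intro power_mono) (simp_all add: energy_nonneg)
    then have "energy m a {..<n} z \<le> real m * (herdisc2 A)\<^sup>2"
      by (simp add: energy_nonneg power_mult_distrib)
    moreover have "\<forall>l\<in>S. z l \<in> {-1, 1}" using \<chi>1 rank by (auto simp: z_def)
    ultimately show ?thesis by (intro exI[of _ z]) (auto simp: z_def)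
  qed
qed

text \<open>Either coloring of a single column yields its norm. Summed over the columns, this
  controls the trace and thereby \<open>\<epsilon>\<close>.\<close>

lemma column_le_herdisc_bound:
  assumes "herdisc_bound m n a H" and "l < n"
  shows "(\<Sum>r<m. (a r l)\<^sup>2) \<le> H"
proof -
  obtain z where z: "z l \<in> {-1, 1}" "\<forall>j. j \<notin> {l} \<longrightarrow> z j = 0" "energy m a {..<n} z \<le> H"
    using assms unfolding herdisc_bound_def by (meson empty_subsetI insert_subset lessThan_iff singletonI)
  have "(\<Sum>j<n. a r j * z j) = a r l * z l" for r
    using z(2) assms(2) by (subst sum.mono_neutral_right[of _ "{l}"]) auto
  moreover have "(a r l * z l)\<^sup>2 = (a r l)\<^sup>2" for r using z(1) by auto
  ultimately show ?thesis using z(3) unfolding energy_def by simp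
qed

lemma sum_row_major:
  fixes g :: "nat \<Rightarrow> real"
  shows "(\<Sum>k<m * n. g k) = (\<Sum>r<m. \<Sum>l<n. g (r * n + l))"
proof -
  have "sum g {r * n..<r * n + n} = (\<Sum>l<n. g (r * n + l))" for r
    by (simp add: sum.atLeastLessThan_shift_0 atLeast0LessThan)
  then show ?thesis using sum.nat_group[of g n m] by simp
qed

lemma disc_const_pos: "disc_const > 0"
  unfolding disc_const_def by simp

text \<open>In the constant, one factor 2 pays for the regularization and one for passing from the
  harmonic number to \<open>log 2 n\<close>. At \<open>n = 1\<close> the logarithm is 0 and the
  bound would fail for a nonzero column, hence the guard \<open>n \<ge> 2\<close>.\<close>

theorem theorem7:
  shows "\<exists>(p :: com) (C :: real) (D :: real). \<forall>(m :: nat) (n :: nat) (A :: real mat).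
    m \<ge> 1 \<longrightarrow> n \<ge> 1 \<longrightarrow> A \<in> carrier_mat m n \<longrightarrow>
    (\<exists>t s. exec p (input_mem A) t s \<and>
       real t \<le> C * (real (m + n) * real n ^ 2) \<and>
       output_vec n s \<in> colorings n \<and>
       (n \<ge> 2 \<longrightarrow>
         disc2_of A (output_vec n s) \<le> D * (sqrt (log 2 (real n)) * herdisc2 A)))"
proof (rule exI[of _ Program], rule exI[of _ 1500], rule exI[of _ "sqrt (4 * disc_const)"], intro allI impI)
  fix m n :: nat and A :: "real mat"
  assume mn: "m \<ge> 1" "n \<ge> 1" and A: "A \<in> carrier_mat m n"
  define s0 where "s0 = input_mem A"
  define a where "a = entry n s0 ''A''"
  define H where "H = real m * (herdisc2 A)\<^sup>2"
  define tr where "tr = (\<Sum>k<m * n. (rcell s0 ''A'' k)\<^sup>2)"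
  define \<epsilon> where "\<epsilon> = (if tr > 0 then tr / real (n * n) else 1)"
  have s0: "ncell s0 ''m'' 0 = m" "ncell s0 ''n'' 0 = n" "rcell s0 ''M'' = (\<lambda>_. 0)" "rcell s0 ''x'' = (\<lambda>_. 0)"
    using A unfolding s0_def input_mem_def by auto
  have a: "a r l = A $$ (r, l)" if "r < m" "l < n" for r l
  proof -
    have "r * n + l < Suc r * n" using that by simp
    also have "\<dots> \<le> m * n" using that by (intro mult_le_mono1) simp
    finally have "r * n + l < m * n" .
    then show ?thesis using A that unfolding a_def entry_def s0_def input_mem_def by simp
  qed
  have HB: "herdisc_bound m n a H" unfolding H_def by (rule herdisc_bound_herdisc2[OF A mn a])
  have trace: "tr = (\<Sum>l<n. \<Sum>r<m. (a r l)\<^sup>2)"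
    unfolding tr_def sum_row_major a_def entry_def by (rule sum.swap)
  have H0: "H \<ge> 0" unfolding H_def by simp
  obtain t s where ex: "exec Program s0 t s" and t: "t \<le> 1500 * ((m + n) * (n * n))"
    and x: "\<And>l. l < n \<Longrightarrow> rcell s ''x'' l \<in> {-1, 1}"
    and E: "energy m a {..<n} (rcell s ''x'') \<le> disc_const * (H + \<epsilon> * real n) * harmonic n"
    using runs_Program[OF s0(1,2) mn s0(3,4) HB[unfolded a_def] tr_def \<epsilon>_def] unfolding runs_def a_def by blast
  have "real t \<le> real (1500 * ((m + n) * (n * n)))" using t by (simp only: of_nat_le_iff)
  then have time: "real t \<le> 1500 * (real (m + n) * real n ^ 2)" by (simp add: power2_eq_square)
  have out: "output_vec n s \<in> colorings n"
    using x unfolding output_vec_def colorings_def by simp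
  have disc: "disc2_of A (output_vec n s) \<le> sqrt (4 * disc_const) * (sqrt (log 2 (real n)) * herdisc2 A)" if "n \<ge> 2"
  proof -
    have log0: "log 2 (real n) \<ge> 0" using that by simp
    have "energy m a {..<n} (rcell s ''x'') \<le> 4 * disc_const * log 2 (real n) * H"
    proof (cases "tr > 0")
      case True
      \<comment> \<open>Every column has squared norm at most \<open>H\<close>, so
        \<open>\<epsilon> * n = tr / n\<close> is at most \<open>H\<close>.\<close>
      have "tr \<le> (\<Sum>l<n. H)"
        unfolding trace by (intro sum_mono column_le_herdisc_bound[OF HB]) simp
      then have "\<epsilon> * real n \<le> H" unfolding \<epsilon>_def using True mn by (simp add: field_simps)
      then have "disc_const * (H + \<epsilon> * real n) * harmonic n \<le> disc_const * (2 * H) * (2 * log 2 (real n))"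
        using disc_const_pos H0 harmonic_le_log[OF that] by (intro mult_mono mult_left_mono) (auto simp: harmonic_nonneg)
      then show ?thesis using E by (simp add: algebra_simps)
    next
      case False
      \<comment> \<open>The trace vanishes only for the zero matrix, where every coloring has energy
        0 and the choice \<open>\<epsilon> = 1\<close> does no harm.\<close>
      then have "tr = 0" unfolding trace by (meson linorder_not_less order_antisym sum_nonneg zero_le_power2)
      then have "\<forall>l<n. \<forall>r<m. a r l = 0"
        unfolding trace by (simp add: sum_nonneg_eq_0_iff sum_nonneg)
      then have "energy m a {..<n} (rcell s ''x'') = 0" unfolding energy_def by simp
      then show ?thesis using disc_const_pos log0 H0 by simp
    qed
    then have "sqrt (energy m a {..<n} (rcell s ''x'')) \<le> sqrt (4 * disc_const * log 2 (real n) * H)" by simp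
    also have "\<dots> = sqrt (4 * disc_const) * sqrt (log 2 (real n)) * (sqrt (real m) * herdisc2 A)"
      unfolding H_def using herdisc2_nonneg[of A] A mn by (simp add: real_sqrt_mult)
    finally have "sqrt (energy m a {..<n} (rcell s ''x'')) / sqrt (real m) \<le>
        sqrt (4 * disc_const) * (sqrt (log 2 (real n)) * herdisc2 A)"
      using mn by (simp add: field_simps)
    moreover have "disc2_of A (output_vec n s) = sqrt (energy m a {..<n} (rcell s ''x'')) / sqrt (real m)"
      by (rule disc2_of_energy[OF A _ a]) (auto simp: output_vec_def)
    ultimately show ?thesis by simp
  qed
  show "\<exists>t s. exec Program (input_mem A) t s \<and> real t \<le> 1500 * (real (m + n) * real n ^ 2) \<and>
       output_vec n s \<in> colorings n \<and>
       (n \<ge> 2 \<longrightarrow> disc2_of A (output_vec n s) \<le> sqrt (4 * disc_const) * (sqrt (log 2 (real n)) * herdisc2 A))"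
    using ex time out disc unfolding s0_def by blast
qed

end
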